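(* Let $S$ be a set of sorts and $\Sigma$ an $S$-sorted signature such that, for every $S$-sorted set $A$, the support $\{s\in S\mid \mathrm{T}_\Sigma(A)_s\neq\varnothing\}$ of the free $\Sigma$-algebra $\mathbf{T}_\Sigma(A)$ is finite (equivalently, $S$ is finite). Then the complete lattices $\mathbf{Form}_{\mathrm{Alg}_{\mathrm{f}}}(\Sigma)$ (all formations of finite $\Sigma$-algebras, ordered by inclusion) and $\mathbf{Form}_{\mathrm{Cgr}_{\mathrm{fi}}}(\Sigma)$ (all formations of finite index congruences with respect to $\Sigma$, ordered pointwise by inclusion) are isomorphic.
   Context: Fix a Grothendieck universe $\mathcal{U}$, a set of sorts $S\in\mathcal{U}$ and an $S$-sorted signature $\Sigma$, i.e. a family of sets $\Sigma_{w,s}\in\mathcal{U}$ indexed by $w\in S^{\star}$ (finite words on $S$) and $s\in S$. An $S$-sorted set is a family $A=(A_s)_{s\in S}$ of sets in $\mathcal{U}$ (components may be empty); it is finite if $\coprod_{s\in S}A_s$ is finite; $\mathcal{U}^S$ is the set of all $S$-sorted sets. A $\Sigma$-algebra $\mathbf{A}$ is an $S$-sorted set $A$ with an operation $F_\sigma\colon A_w=\prod_{i<|w|}A_{w_i}\to A_s$ for each $\sigma\in\Sigma_{w,s}$; it is finite if $A$ is finite. Homomorphisms are $S$-sorted (componentwise) mappings commuting with all operations. Epimorphism means homomorphism surjective in each sort. $\mathrm{Alg}(\Sigma)$ is the set of all $\Sigma$-algebras; a "set of $\Sigma$-algebras" is any subset of it (not necessarily $\mathcal{U}$-small). A congruence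 on $\mathbf{A}$ is a family $\Phi=(\Phi_s)_{s\in S}$ of equivalence relations $\Phi_s$ on $A_s$ compatible with all operations; $\Phi$ is of finite index if $A/\Phi$ is a finite $S$-sorted set. $\mathbf{Cgr}(\mathbf{A})$ is the lattice of all congruences under componentwise inclusion, $\mathbf{A}/\Phi$ the quotient algebra and $\mathrm{pr}^{\Phi}\colon\mathbf{A}\to\mathbf{A}/\Phi$ the projection. $\mathbf{T}_\Sigma(A)$ is the free $\Sigma$-algebra on $A$. $\mathrm{Ker}(f)$ is the (componentwise) kernel congruence of $f$. A subdirect embedding $f\colon\mathbf{A}\to\prod_{i\in I}\mathbf{C}^i$ is a homomorphism injective in each sort such that each $\mathrm{pr}^i\circ f\colon\mathbf{A}\to\mathbf{C}^i$ is surjective (the empty product is the final algebra $\mathbf{1}$, with one element in each sort). A formation of $\Sigma$-algebras is a set $\mathcal{F}\subseteq\mathrm{Alg}(\Sigma)$ such that: (1) $\mathcal{F}\neq\varnothing$; (2) $\mathcal{F}$ is closed under isomorphism; (3) if $\mathbf{B}\in\mathcal{F}$ and there is an epimorphism $\mathbf{B}\to\mathbf{A}$, then $\mathbf{A}\in\mathcal{F}$; (4) if for some $n\in\mathbb{N}$ (including $n=0$) and some family $(\mathbf{C}^{\alpha})_{\alpha<n}$ in $\mathcal{F}$ there is a subdirect embedding $\mathbf{A}\to\prod_{\alpha<n}\mathbf{C}^{\alpha}$, then $\mathbf{A}\in\mathcal{F}$. A formation of finite $\Sigma$-algebras is a formation of $\Sigma$-algebras all of whose members are finite. A formation of congruences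 with respect to $\Sigma$ is a function $\mathfrak{F}$ on $\mathcal{U}^S$ such that: (1) for every $A\in\mathcal{U}^S$, $\mathfrak{F}(A)$ is a filter of $\mathbf{Cgr}(\mathbf{T}_\Sigma(A))$ (nonempty, closed under binary intersection, upward closed); (2) for all $A,B\in\mathcal{U}^S$, $\Theta\in\mathfrak{F}(B)$ and homomorphisms $f\colon\mathbf{T}_\Sigma(A)\to\mathbf{T}_\Sigma(B)$, if $\mathrm{pr}^{\Theta}\circ f$ is an epimorphism, then $\mathrm{Ker}(\mathrm{pr}^{\Theta}\circ f)\in\mathfrak{F}(A)$. It is a formation of finite index congruences if moreover, for every $A$, every member of $\mathfrak{F}(A)$ is of finite index. The order is $\mathfrak{F}\le\mathfrak{G}$ iff $\mathfrak{F}(A)\subseteq\mathfrak{G}(A)$ for all $A\in\mathcal{U}^S$. *)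

theory Defs
  imports "HOL-Algebra.Complete_Lattice" "HOL-Library.FuncSet"
begin

section \<open>Grothendieck universes\<close>

text \<open>
  The elements of the universe form the type \<open>'u\<close>, and \<open>elts x\<close> is the set of members of \<open>x\<close>.
  Members of members of the universe therefore lie in the universe automatically, and the
  universe, viewed as a collection of sets, is \<open>range elts\<close>. The first two conditions say that
  \<open>elts\<close> behaves as genuine membership (extensionality and foundation); the others are the closure
  conditions: pairs, subsets and power sets, and unions of families indexed by a member of the
  universe. The universe of hereditarily finite sets is not excluded.
\<close>

definition grothendieck_universe :: "('u \<Rightarrow> 'u set) \<Rightarrow> bool" where
  "grothendieck_universe elts \<longleftrightarrow>
     inj elts \<and>
     wf {(x, y). x \<in> elts y} \<and>
     (\<forall>x y. {x, y} \<in> range elts) \<and>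
     (\<forall>x Y. Y \<subseteq> elts x \<longrightarrow> Y \<in> range elts) \<and>
     (\<forall>x. {y. elts y \<subseteq> elts x} \<in> range elts) \<and>
     (\<forall>i f. (\<Union>x\<in>elts i. elts (f x)) \<in> range elts)"


section \<open>Sorted sets, signatures and algebras\<close>

text \<open>
  Families indexed by the set of sorts \<open>S\<close> are functions on the type of sorts that are
  \<open>undefined\<close> outside \<open>S\<close>, so that equality of families is equality of functions.
  Below, \<open>U\<close> is a collection of sets and \<open>sorted_sets U S\<close> is the set of all \<open>S\<close>-sorted sets with
  components in \<open>U\<close>.
\<close>

definition sorted_sets :: "'a set set \<Rightarrow> 's set \<Rightarrow> ('s \<Rightarrow> 'a set) set" where
  "sorted_sets U S = S \<rightarrow>\<^sub>E U"

definition sorted_finite :: "'s set \<Rightarrow> ('s \<Rightarrow> 'a set) \<Rightarrow> bool" where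
  "sorted_finite S A \<longleftrightarrow> finite (SIGMA s:S. A s)"

definition word_prod :: "('s \<Rightarrow> 'a set) \<Rightarrow> 's list \<Rightarrow> 'a list set" where
  "word_prod A w = {xs. length xs = length w \<and> (\<forall>i<length w. xs ! i \<in> A (w ! i))}"

text \<open>
  A signature \<open>\<Sigma>\<close> assigns to \<open>w\<close> and \<open>s\<close> the set \<open>\<Sigma> w s\<close>. Since these sets need not be disjoint,
  an operation symbol is recorded together with its arity and coarity. The values of \<open>\<Sigma>\<close> at words
  or sorts that are not over \<open>S\<close> are ignored.
\<close>

type_synonym ('s, 'f) opsym = "'s list \<times> 's \<times> 'f"

definition opsyms :: "'s set \<Rightarrow> ('s list \<Rightarrow> 's \<Rightarrow> 'f set) \<Rightarrow> ('s, 'f) opsym set" where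
  "opsyms S \<Sigma> = {(w, s, \<sigma>). w \<in> lists S \<and> s \<in> S \<and> \<sigma> \<in> \<Sigma> w s}"

record ('s, 'f, 'a) salgebra =
  Car :: "'s \<Rightarrow> 'a set"
  Opn :: "('s, 'f) opsym \<Rightarrow> 'a list \<Rightarrow> 'a"

definition is_algebra ::
    "'s set \<Rightarrow> ('s list \<Rightarrow> 's \<Rightarrow> 'f set) \<Rightarrow> ('s, 'f, 'a) salgebra \<Rightarrow> bool" where
  "is_algebra S \<Sigma> A \<longleftrightarrow>
     Car A \<in> extensional S \<and>
     Opn A \<in> (\<Pi>\<^sub>E p\<in>opsyms S \<Sigma>. case p of (w, s, \<sigma>) \<Rightarrow> word_prod (Car A) w \<rightarrow>\<^sub>E Car A s)"

definition Alg ::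
    "'a set set \<Rightarrow> 's set \<Rightarrow> ('s list \<Rightarrow> 's \<Rightarrow> 'f set) \<Rightarrow> ('s, 'f, 'a) salgebra set" where
  "Alg U S \<Sigma> = {A. is_algebra S \<Sigma> A \<and> Car A \<in> sorted_sets U S}"

definition finite_algebra :: "'s set \<Rightarrow> ('s, 'f, 'a) salgebra \<Rightarrow> bool" where
  "finite_algebra S A \<longleftrightarrow> sorted_finite S (Car A)"


section \<open>Homomorphisms\<close>

text \<open>As for \<open>hom\<close> in \<open>HOL-Algebra\<close>, only the values on the carriers matter.\<close>

definition shom ::
    "'s set \<Rightarrow> ('s list \<Rightarrow> 's \<Rightarrow> 'f set) \<Rightarrow> ('s, 'f, 'a) salgebra \<Rightarrow> ('s, 'f, 'b) salgebra
      \<Rightarrow> ('s \<Rightarrow> 'a \<Rightarrow> 'b) set" where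
  "shom S \<Sigma> A B =
     {f. (\<forall>s\<in>S. f s \<in> Car A s \<rightarrow> Car B s) \<and>
         (\<forall>(w, s, \<sigma>)\<in>opsyms S \<Sigma>. \<forall>xs\<in>word_prod (Car A) w.
            f s (Opn A (w, s, \<sigma>) xs) = Opn B (w, s, \<sigma>) (map2 f w xs))}"

definition sepi ::
    "'s set \<Rightarrow> ('s list \<Rightarrow> 's \<Rightarrow> 'f set) \<Rightarrow> ('s, 'f, 'a) salgebra \<Rightarrow> ('s, 'f, 'b) salgebra
      \<Rightarrow> ('s \<Rightarrow> 'a \<Rightarrow> 'b) set" where
  "sepi S \<Sigma> A B = {f \<in> shom S \<Sigma> A B. \<forall>s\<in>S. f s ` Car A s = Car B s}"

definition siso ::
    "'s set \<Rightarrow> ('s list \<Rightarrow> 's \<Rightarrow> 'f set) \<Rightarrow> ('s, 'f, 'a) salgebra \<Rightarrow> ('s, 'f, 'b) salgebra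
      \<Rightarrow> ('s \<Rightarrow> 'a \<Rightarrow> 'b) set" where
  "siso S \<Sigma> A B = {f \<in> shom S \<Sigma> A B. \<forall>s\<in>S. bij_betw (f s) (Car A s) (Car B s)}"

definition scomp :: "('s \<Rightarrow> 'b \<Rightarrow> 'c) \<Rightarrow> ('s \<Rightarrow> 'a \<Rightarrow> 'b) \<Rightarrow> 's \<Rightarrow> 'a \<Rightarrow> 'c" where
  "scomp g f = (\<lambda>s. g s \<circ> f s)"


section \<open>Products and subdirect embeddings\<close>

text \<open>
  For empty \<open>I\<close> every carrier of the product is a singleton, so this is the final algebra.
\<close>

definition prod_algebra ::
    "'s set \<Rightarrow> ('s list \<Rightarrow> 's \<Rightarrow> 'f set) \<Rightarrow> 'i set \<Rightarrow> ('i \<Rightarrow> ('s, 'f, 'a) salgebra)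
      \<Rightarrow> ('s, 'f, 'i \<Rightarrow> 'a) salgebra" where
  "prod_algebra S \<Sigma> I C =
    (let P = (\<lambda>s\<in>S. \<Pi>\<^sub>E i\<in>I. Car (C i) s) in
     \<lparr>Car = P,
      Opn = (\<lambda>(w, s, \<sigma>)\<in>opsyms S \<Sigma>. \<lambda>gs\<in>word_prod P w.
               \<lambda>i\<in>I. Opn (C i) (w, s, \<sigma>) (map (\<lambda>g. g i) gs))\<rparr>)"

definition subdirect_embedding ::
    "'s set \<Rightarrow> ('s list \<Rightarrow> 's \<Rightarrow> 'f set) \<Rightarrow> ('s, 'f, 'b) salgebra \<Rightarrow> 'i set
      \<Rightarrow> ('i \<Rightarrow> ('s, 'f, 'a) salgebra) \<Rightarrow> ('s \<Rightarrow> 'b \<Rightarrow> 'i \<Rightarrow> 'a) \<Rightarrow> bool" where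
  "subdirect_embedding S \<Sigma> A I C f \<longleftrightarrow>
     f \<in> shom S \<Sigma> A (prod_algebra S \<Sigma> I C) \<and>
     (\<forall>s\<in>S. inj_on (f s) (Car A s)) \<and>
     (\<forall>i\<in>I. \<forall>s\<in>S. (\<lambda>x. f s x i) ` Car A s = Car (C i) s)"


section \<open>Congruences and quotients\<close>

definition congruences ::
    "'s set \<Rightarrow> ('s list \<Rightarrow> 's \<Rightarrow> 'f set) \<Rightarrow> ('s, 'f, 'a) salgebra \<Rightarrow> ('s \<Rightarrow> ('a \<times> 'a) set) set" where
  "congruences S \<Sigma> A =
     {\<Phi>. \<Phi> \<in> extensional S \<and>
          (\<forall>s\<in>S. equiv (Car A s) (\<Phi> s)) \<and>
          (\<forall>(w, s, \<sigma>)\<in>opsyms S \<Sigma>. \<forall>xs\<in>word_prod (Car A) w. \<forall>ys\<in>word_prod (Car A) w.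
             (\<forall>i<length w. (xs ! i, ys ! i) \<in> \<Phi> (w ! i)) \<longrightarrow>
             (Opn A (w, s, \<sigma>) xs, Opn A (w, s, \<sigma>) ys) \<in> \<Phi> s)}"

definition cgr_le :: "'s set \<Rightarrow> ('s \<Rightarrow> ('a \<times> 'a) set) \<Rightarrow> ('s \<Rightarrow> ('a \<times> 'a) set) \<Rightarrow> bool" where
  "cgr_le S \<Phi> \<Psi> \<longleftrightarrow> (\<forall>s\<in>S. \<Phi> s \<subseteq> \<Psi> s)"

definition cgr_inter ::
    "'s set \<Rightarrow> ('s \<Rightarrow> ('a \<times> 'a) set) \<Rightarrow> ('s \<Rightarrow> ('a \<times> 'a) set) \<Rightarrow> 's \<Rightarrow> ('a \<times> 'a) set" where
  "cgr_inter S \<Phi> \<Psi> = (\<lambda>s\<in>S. \<Phi> s \<inter> \<Psi> s)"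

text \<open>
  The union in the definition of the operations ranges over all tuples of representatives of the
  classes \<open>Xs\<close>; for a congruence all its members are the same class.
\<close>

definition quot_algebra ::
    "'s set \<Rightarrow> ('s list \<Rightarrow> 's \<Rightarrow> 'f set) \<Rightarrow> ('s, 'f, 'a) salgebra \<Rightarrow> ('s \<Rightarrow> ('a \<times> 'a) set)
      \<Rightarrow> ('s, 'f, 'a set) salgebra" where
  "quot_algebra S \<Sigma> A \<Phi> =
    (let Q = (\<lambda>s\<in>S. Car A s // \<Phi> s) in
     \<lparr>Car = Q,
      Opn = (\<lambda>(w, s, \<sigma>)\<in>opsyms S \<Sigma>. \<lambda>Xs\<in>word_prod Q w.
               \<Union>xs\<in>{xs. list_all2 (\<in>) xs Xs}. \<Phi> s `` {Opn A (w, s, \<sigma>) xs})\<rparr>)"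

definition quot_proj :: "('s \<Rightarrow> ('a \<times> 'a) set) \<Rightarrow> 's \<Rightarrow> 'a \<Rightarrow> 'a set" where
  "quot_proj \<Phi> = (\<lambda>s x. \<Phi> s `` {x})"

definition finite_index ::
    "'s set \<Rightarrow> ('s, 'f, 'a) salgebra \<Rightarrow> ('s \<Rightarrow> ('a \<times> 'a) set) \<Rightarrow> bool" where
  "finite_index S A \<Phi> \<longleftrightarrow> sorted_finite S (\<lambda>s. Car A s // \<Phi> s)"

definition Ker ::
    "'s set \<Rightarrow> ('s, 'f, 'a) salgebra \<Rightarrow> ('s \<Rightarrow> 'a \<Rightarrow> 'b) \<Rightarrow> 's \<Rightarrow> ('a \<times> 'a) set" where
  "Ker S A f = (\<lambda>s\<in>S. {(x, y). x \<in> Car A s \<and> y \<in> Car A s \<and> f s x = f s y})"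

definition cgr_filter ::
    "'s set \<Rightarrow> ('s list \<Rightarrow> 's \<Rightarrow> 'f set) \<Rightarrow> ('s, 'f, 'a) salgebra
      \<Rightarrow> ('s \<Rightarrow> ('a \<times> 'a) set) set \<Rightarrow> bool" where
  "cgr_filter S \<Sigma> A X \<longleftrightarrow>
     X \<subseteq> congruences S \<Sigma> A \<and>
     X \<noteq> {} \<and>
     (\<forall>\<Phi>\<in>X. \<forall>\<Psi>\<in>X. cgr_inter S \<Phi> \<Psi> \<in> X) \<and>
     (\<forall>\<Phi>\<in>X. \<forall>\<Psi>\<in>congruences S \<Sigma> A. cgr_le S \<Phi> \<Psi> \<longrightarrow> \<Psi> \<in> X)"


section \<open>Free algebras\<close>

text \<open>
  The free algebra on a sorted set is the algebra of well-sorted terms. It lives on a type of its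
  own rather than inside the universe; nothing below depends on more than its isomorphism type.
\<close>

datatype ('s, 'f, 'a) trm = Var 's 'a | App "('s, 'f) opsym" "('s, 'f, 'a) trm list"

inductive well_sorted ::
    "'s set \<Rightarrow> ('s list \<Rightarrow> 's \<Rightarrow> 'f set) \<Rightarrow> ('s \<Rightarrow> 'a set) \<Rightarrow> 's \<Rightarrow> ('s, 'f, 'a) trm \<Rightarrow> bool"
  for S \<Sigma> A where
  var: "s \<in> S \<Longrightarrow> a \<in> A s \<Longrightarrow> well_sorted S \<Sigma> A s (Var s a)"
| app: "(w, s, \<sigma>) \<in> opsyms S \<Sigma> \<Longrightarrow> length ts = length w \<Longrightarrow>
        (\<And>i. i < length w \<Longrightarrow> well_sorted S \<Sigma> A (w ! i) (ts ! i)) \<Longrightarrow>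
        well_sorted S \<Sigma> A s (App (w, s, \<sigma>) ts)"

definition free_algebra ::
    "'s set \<Rightarrow> ('s list \<Rightarrow> 's \<Rightarrow> 'f set) \<Rightarrow> ('s \<Rightarrow> 'a set)
      \<Rightarrow> ('s, 'f, ('s, 'f, 'a) trm) salgebra" where
  "free_algebra S \<Sigma> A =
    (let T = (\<lambda>s\<in>S. {t. well_sorted S \<Sigma> A s t}) in
     \<lparr>Car = T,
      Opn = (\<lambda>(w, s, \<sigma>)\<in>opsyms S \<Sigma>. \<lambda>ts\<in>word_prod T w. App (w, s, \<sigma>) ts)\<rparr>)"

definition support :: "'s set \<Rightarrow> ('s \<Rightarrow> 'a set) \<Rightarrow> 's set" where
  "support S A = {s \<in> S. A s \<noteq> {}}"


section \<open>Formations\<close>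

definition algebra_formation ::
    "'a set set \<Rightarrow> 's set \<Rightarrow> ('s list \<Rightarrow> 's \<Rightarrow> 'f set) \<Rightarrow> ('s, 'f, 'a) salgebra set \<Rightarrow> bool" where
  "algebra_formation U S \<Sigma> F \<longleftrightarrow>
     F \<subseteq> Alg U S \<Sigma> \<and>
     F \<noteq> {} \<and>
     (\<forall>B\<in>F. \<forall>A\<in>Alg U S \<Sigma>. siso S \<Sigma> B A \<noteq> {} \<longrightarrow> A \<in> F) \<and>
     (\<forall>B\<in>F. \<forall>A\<in>Alg U S \<Sigma>. sepi S \<Sigma> B A \<noteq> {} \<longrightarrow> A \<in> F) \<and>
     (\<forall>(n::nat) C. \<forall>A\<in>Alg U S \<Sigma>.
        (\<forall>\<alpha><n. C \<alpha> \<in> F) \<longrightarrow> (\<exists>f. subdirect_embedding S \<Sigma> A {..<n} C f) \<longrightarrow> A \<in> F)"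

definition finite_algebra_formation ::
    "'a set set \<Rightarrow> 's set \<Rightarrow> ('s list \<Rightarrow> 's \<Rightarrow> 'f set) \<Rightarrow> ('s, 'f, 'a) salgebra set \<Rightarrow> bool" where
  "finite_algebra_formation U S \<Sigma> F \<longleftrightarrow>
     algebra_formation U S \<Sigma> F \<and> (\<forall>A\<in>F. finite_algebra S A)"

text \<open>A family of congruences on the free algebras on all sorted sets with components in \<open>U\<close>.\<close>

type_synonym ('s, 'f, 'a) cgr_family =
  "('s \<Rightarrow> 'a set) \<Rightarrow> ('s \<Rightarrow> (('s, 'f, 'a) trm \<times> ('s, 'f, 'a) trm) set) set"

definition congruence_formation ::
    "'a set set \<Rightarrow> 's set \<Rightarrow> ('s list \<Rightarrow> 's \<Rightarrow> 'f set) \<Rightarrow> ('s, 'f, 'a) cgr_family \<Rightarrow> bool" where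
  "congruence_formation U S \<Sigma> F \<longleftrightarrow>
     F \<in> extensional (sorted_sets U S) \<and>
     (\<forall>A\<in>sorted_sets U S. cgr_filter S \<Sigma> (free_algebra S \<Sigma> A) (F A)) \<and>
     (\<forall>A\<in>sorted_sets U S. \<forall>B\<in>sorted_sets U S. \<forall>\<Theta>\<in>F B.
        \<forall>f\<in>shom S \<Sigma> (free_algebra S \<Sigma> A) (free_algebra S \<Sigma> B).
          scomp (quot_proj \<Theta>) f
            \<in> sepi S \<Sigma> (free_algebra S \<Sigma> A) (quot_algebra S \<Sigma> (free_algebra S \<Sigma> B) \<Theta>) \<longrightarrow>
          Ker S (free_algebra S \<Sigma> A) (scomp (quot_proj \<Theta>) f) \<in> F A)"

definition finite_index_congruence_formation ::
    "'a set set \<Rightarrow> 's set \<Rightarrow> ('s list \<Rightarrow> 's \<Rightarrow> 'f set) \<Rightarrow> ('s, 'f, 'a) cgr_family \<Rightarrow> bool" where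
  "finite_index_congruence_formation U S \<Sigma> F \<longleftrightarrow>
     congruence_formation U S \<Sigma> F \<and>
     (\<forall>A\<in>sorted_sets U S. \<forall>\<Theta>\<in>F A. finite_index S (free_algebra S \<Sigma> A) \<Theta>)"

definition Form_Algf ::
    "'a set set \<Rightarrow> 's set \<Rightarrow> ('s list \<Rightarrow> 's \<Rightarrow> 'f set) \<Rightarrow> ('s, 'f, 'a) salgebra set gorder" where
  "Form_Algf U S \<Sigma> =
     \<lparr>carrier = {F. finite_algebra_formation U S \<Sigma> F}, eq = (=), le = (\<subseteq>)\<rparr>"

definition Form_Cgrfi ::
    "'a set set \<Rightarrow> 's set \<Rightarrow> ('s list \<Rightarrow> 's \<Rightarrow> 'f set) \<Rightarrow> ('s, 'f, 'a) cgr_family gorder" where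
  "Form_Cgrfi U S \<Sigma> =
     \<lparr>carrier = {F. finite_index_congruence_formation U S \<Sigma> F}, eq = (=),
      le = (\<lambda>F G. \<forall>A\<in>sorted_sets U S. F A \<subseteq> G A)\<rparr>"

text \<open>For lattices, isomorphisms are the same as order isomorphisms.\<close>

definition lattice_isomorphic :: "'a gorder \<Rightarrow> 'b gorder \<Rightarrow> bool" where
  "lattice_isomorphic L M \<longleftrightarrow> (\<exists>h. bij_betw h (carrier L) (carrier M) \<and> order_emb L M h)"

end

theory Submission
  imports Defs
begin

text \<open>
  A formation \<open>F\<close> of finite algebras corresponds to the family of kernels of epimorphisms from free
  algebras onto members of \<open>F\<close>; conversely a family \<open>G\<close> of congruences corresponds to the algebras
  that are images of a free algebra with kernel in \<open>G\<close>. Projectivity of free algebras shows that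
  the choice of the presenting epimorphism is immaterial, so the two assignments are mutually
  inverse. Evaluating the support hypothesis on a family of singletons shows that \<open>S\<close> is finite; hence
  finite index means finitely many classes in each sort, the final algebra is finite, and the
  formations of finite algebras are closed under arbitrary intersections and have a greatest element.
\<close>

section \<open>Algebras and homomorphisms\<close>

text \<open>Free algebras and their quotients are built on terms and on sets of terms, not on
  elements of the universe, so such a quotient cannot itself be a member of a formation; over the
  hereditarily finite sets a free algebra may not even have a copy there. Finiteness removes the
  obstacle: a finite quotient can be copied sort by sort, because there are infinitely many elements
  and every finite set of them belongs to the universe. Hence quotients are handled through
  epimorphisms and their kernels, and a quotient is shown to have finite index before it is copied.
  In the other direction every algebra is an image of the free algebra on its own carrier, so no
  member of a formation is missed. Epimorphic images correspond to larger kernels and finite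
  subdirect products to finite intersections of kernels; this matches conditions (3) and (4) with
  the filter laws, the empty product giving the full congruence.\<close>

lemma opsyms_sort: "(w, s, \<sigma>) \<in> opsyms S \<Sigma> \<Longrightarrow> s \<in> S"
  and opsyms_nth: "(w, s, \<sigma>) \<in> opsyms S \<Sigma> \<Longrightarrow> i < length w \<Longrightarrow> w ! i \<in> S"
  by (auto simp: opsyms_def in_lists_conv_set)

lemma word_prod_map2:
  assumes "xs \<in> word_prod A w" "\<And>i. i < length w \<Longrightarrow> f (w ! i) \<in> A (w ! i) \<rightarrow> B (w ! i)"
  shows "map2 f w xs \<in> word_prod B w"
  using assms by (fastforce simp: word_prod_def Pi_iff)

lemma algebra_closed:
  assumes "is_algebra S \<Sigma> A" "(w, s, \<sigma>) \<in> opsyms S \<Sigma>" "xs \<in> word_prod (Car A) w"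
  shows "Opn A (w, s, \<sigma>) xs \<in> Car A s"
  using assms unfolding is_algebra_def by fastforce

lemma is_algebraI:
  assumes "P \<in> extensional S"
    and "\<And>w s \<sigma> xs. (w, s, \<sigma>) \<in> opsyms S \<Sigma> \<Longrightarrow> xs \<in> word_prod P w \<Longrightarrow> F w s \<sigma> xs \<in> P s"
  shows "is_algebra S \<Sigma>
    \<lparr>Car = P, Opn = (\<lambda>(w, s, \<sigma>)\<in>opsyms S \<Sigma>. \<lambda>xs\<in>word_prod P w. F w s \<sigma> xs)\<rparr>"
  using assms by (auto simp: is_algebra_def PiE_iff split: prod.split)

lemma shomI:
  assumes "\<And>s x. s \<in> S \<Longrightarrow> x \<in> Car A s \<Longrightarrow> f s x \<in> Car B s"
    and "\<And>w s \<sigma> xs. (w, s, \<sigma>) \<in> opsyms S \<Sigma> \<Longrightarrow> xs \<in> word_prod (Car A) w \<Longrightarrow>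
      f s (Opn A (w, s, \<sigma>) xs) = Opn B (w, s, \<sigma>) (map2 f w xs)"
  shows "f \<in> shom S \<Sigma> A B"
  using assms unfolding shom_def by auto

lemma shom_closed: "f \<in> shom S \<Sigma> A B \<Longrightarrow> s \<in> S \<Longrightarrow> x \<in> Car A s \<Longrightarrow> f s x \<in> Car B s"
  unfolding shom_def by auto

lemma shom_Opn:
  "f \<in> shom S \<Sigma> A B \<Longrightarrow> (w, s, \<sigma>) \<in> opsyms S \<Sigma> \<Longrightarrow> xs \<in> word_prod (Car A) w \<Longrightarrow>
    f s (Opn A (w, s, \<sigma>) xs) = Opn B (w, s, \<sigma>) (map2 f w xs)"
  unfolding shom_def by blast

lemma shom_word_prod:
  assumes "f \<in> shom S \<Sigma> A B" "(w, s, \<sigma>) \<in> opsyms S \<Sigma>" "xs \<in> word_prod (Car A) w"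
  shows "map2 f w xs \<in> word_prod (Car B) w"
  using assms opsyms_nth[OF assms(2)] by (intro word_prod_map2[OF assms(3)]) (auto dest: shom_closed)

lemma shom_comp:
  assumes f: "f \<in> shom S \<Sigma> A B" and g: "g \<in> shom S \<Sigma> B C"
  shows "scomp g f \<in> shom S \<Sigma> A C"
proof (rule shomI)
  show "scomp g f s x \<in> Car C s" if "s \<in> S" "x \<in> Car A s" for s x
    using that f g by (simp add: scomp_def shom_closed)
next
  fix w s \<sigma> xs assume p: "(w, s, \<sigma>) \<in> opsyms S \<Sigma>" "xs \<in> word_prod (Car A) w"
  have "map2 g w (map2 f w xs) = map2 (scomp g f) w xs"
    using p(2) by (intro nth_equalityI) (auto simp: word_prod_def scomp_def)
  with shom_Opn[OF f p] shom_Opn[OF g p(1) shom_word_prod[OF f p]]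
  show "scomp g f s (Opn A (w, s, \<sigma>) xs) = Opn C (w, s, \<sigma>) (map2 (scomp g f) w xs)"
    by (simp add: scomp_def)
qed

lemma sepi_shom: "f \<in> sepi S \<Sigma> A B \<Longrightarrow> f \<in> shom S \<Sigma> A B"
  and sepi_image: "f \<in> sepi S \<Sigma> A B \<Longrightarrow> s \<in> S \<Longrightarrow> f s ` Car A s = Car B s"
  by (auto simp: sepi_def)

lemma sepi_comp:
  assumes "f \<in> sepi S \<Sigma> A B" "g \<in> sepi S \<Sigma> B C"
  shows "scomp g f \<in> sepi S \<Sigma> A C"
proof -
  have "scomp g f s ` Car A s = Car C s" if "s \<in> S" for s
    using sepi_image[OF assms(1) that, symmetric] sepi_image[OF assms(2) that, symmetric]
    by (simp add: scomp_def image_comp)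
  then show ?thesis
    using assms by (auto simp: sepi_def intro: shom_comp)
qed

lemma siso_sepi: "f \<in> siso S \<Sigma> A B \<Longrightarrow> f \<in> sepi S \<Sigma> A B"
  by (auto simp: siso_def sepi_def bij_betw_def)

section \<open>Kernels and congruences\<close>

lemma Ker_iff: "s \<in> S \<Longrightarrow> (x, y) \<in> Ker S A f s \<longleftrightarrow> x \<in> Car A s \<and> y \<in> Car A s \<and> f s x = f s y"
  by (simp add: Ker_def)

lemma Ker_extensional: "Ker S A f \<in> extensional S"
  by (simp add: Ker_def)

lemma Ker_congruence:
  assumes A: "is_algebra S \<Sigma> A" and f: "f \<in> shom S \<Sigma> A B"
  shows "Ker S A f \<in> congruences S \<Sigma> A"
proof -
  have "(Opn A (w, s, \<sigma>) xs, Opn A (w, s, \<sigma>) ys) \<in> Ker S A f s"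
    if p: "(w, s, \<sigma>) \<in> opsyms S \<Sigma>" and xs: "xs \<in> word_prod (Car A) w"
      and ys: "ys \<in> word_prod (Car A) w"
      and xy: "\<forall>i<length w. (xs ! i, ys ! i) \<in> Ker S A f (w ! i)" for w s \<sigma> xs ys
  proof -
    have "map2 f w xs = map2 f w ys"
      using xs ys xy opsyms_nth[OF p]
      by (intro nth_equalityI) (auto simp: word_prod_def Ker_iff)
    with p xs ys show ?thesis
      by (simp add: Ker_iff opsyms_sort[OF p] algebra_closed[OF A] shom_Opn[OF f])
  qed
  moreover have "equiv (Car A s) (Ker S A f s)" if "s \<in> S" for s
    using that by (auto simp: Ker_def intro!: equivI refl_onI symI transI)
  ultimately show ?thesis
    by (auto simp: congruences_def Ker_extensional)
qed

lemma congruence_equiv: "\<Phi> \<in> congruences S \<Sigma> A \<Longrightarrow> s \<in> S \<Longrightarrow> equiv (Car A s) (\<Phi> s)"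
  by (simp add: congruences_def)

lemma congruence_Opn:
  assumes "\<Phi> \<in> congruences S \<Sigma> A" "(w, s, \<sigma>) \<in> opsyms S \<Sigma>" "xs \<in> word_prod (Car A) w"
    "ys \<in> word_prod (Car A) w" "\<And>i. i < length w \<Longrightarrow> (xs ! i, ys ! i) \<in> \<Phi> (w ! i)"
  shows "(Opn A (w, s, \<sigma>) xs, Opn A (w, s, \<sigma>) ys) \<in> \<Phi> s"
  using assms unfolding congruences_def by blast

lemma congruences_ext: "\<Phi> \<in> congruences S \<Sigma> A \<Longrightarrow> \<Phi> \<in> extensional S"
  by (simp add: congruences_def)

lemma full_congruence:
  assumes "is_algebra S \<Sigma> A"
  shows "(\<lambda>s\<in>S. Car A s \<times> Car A s) \<in> congruences S \<Sigma> A"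
  using assms algebra_closed[OF assms] opsyms_sort
  by (fastforce simp: congruences_def equiv_def refl_on_def sym_def trans_def)

lemma cgr_inter_congruence:
  assumes \<Phi>: "\<Phi> \<in> congruences S \<Sigma> A" and \<Psi>: "\<Psi> \<in> congruences S \<Sigma> A"
  shows "cgr_inter S \<Phi> \<Psi> \<in> congruences S \<Sigma> A"
proof -
  have "(Opn A (w, s, \<sigma>) xs, Opn A (w, s, \<sigma>) ys) \<in> cgr_inter S \<Phi> \<Psi> s"
    if p: "(w, s, \<sigma>) \<in> opsyms S \<Sigma>" "xs \<in> word_prod (Car A) w" "ys \<in> word_prod (Car A) w"
      "\<forall>i<length w. (xs ! i, ys ! i) \<in> cgr_inter S \<Phi> \<Psi> (w ! i)" for w s \<sigma> xs ys
    using congruence_Opn[OF \<Phi> p(1-3)] congruence_Opn[OF \<Psi> p(1-3)] p(4)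
    by (simp add: cgr_inter_def opsyms_nth[OF p(1)] opsyms_sort[OF p(1)])
  moreover have "equiv (Car A s) (cgr_inter S \<Phi> \<Psi> s)" if "s \<in> S" for s
    using congruence_equiv[OF \<Phi> that] congruence_equiv[OF \<Psi> that] that
    by (auto simp: cgr_inter_def equiv_def refl_on_Int[of "Car A s" _ "Car A s", simplified]
        sym_Int trans_Int)
  moreover have "cgr_inter S \<Phi> \<Psi> \<in> extensional S"
    by (simp add: cgr_inter_def)
  ultimately show ?thesis
    by (auto simp: congruences_def)
qed

lemma Ker_quot_proj:
  assumes "\<Phi> \<in> congruences S \<Sigma> A"
  shows "Ker S A (quot_proj \<Phi>) = \<Phi>"
proof (rule extensionalityI[OF Ker_extensional congruences_ext[OF assms]])
  fix s assume s: "s \<in> S"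
  then have "equiv (Car A s) (\<Phi> s)" by (rule congruence_equiv[OF assms])
  then show "Ker S A (quot_proj \<Phi>) s = \<Phi> s"
    using s by (auto simp: Ker_iff quot_proj_def eq_equiv_class_iff equiv_class_eq
        dest: equiv_class_eq_iff[THEN iffD1])
qed

text \<open>Allows a projection modulo a kernel to be traded for the map itself, so that condition
  (2) for congruences can be checked on epimorphisms onto algebras instead of on quotients.\<close>

lemma quot_proj_Ker_eq_iff:
  assumes "is_algebra S \<Sigma> A" "f \<in> shom S \<Sigma> A B" "s \<in> S" "x \<in> Car A s" "y \<in> Car A s"
  shows "quot_proj (Ker S A f) s x = quot_proj (Ker S A f) s y \<longleftrightarrow> f s x = f s y"
  using Ker_quot_proj[OF Ker_congruence[OF assms(1,2)]] assms(3-5) by (metis Ker_iff)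

lemma quot_proj_sepi:
  assumes A: "is_algebra S \<Sigma> A" and \<Phi>: "\<Phi> \<in> congruences S \<Sigma> A"
  shows "quot_proj \<Phi> \<in> sepi S \<Sigma> A (quot_algebra S \<Sigma> A \<Phi>)"
proof -
  have im: "quot_proj \<Phi> s ` Car A s = Car (quot_algebra S \<Sigma> A \<Phi>) s" if "s \<in> S" for s
    using that by (auto simp: quot_algebra_def quot_proj_def quotient_def Let_def)
  have "quot_proj \<Phi> \<in> shom S \<Sigma> A (quot_algebra S \<Sigma> A \<Phi>)"
  proof (rule shomI)
    show "quot_proj \<Phi> s x \<in> Car (quot_algebra S \<Sigma> A \<Phi>) s" if "s \<in> S" "x \<in> Car A s" for s x
      using im that by blast
  next
    fix w s \<sigma> xs assume p: "(w, s, \<sigma>) \<in> opsyms S \<Sigma>" and xs: "xs \<in> word_prod (Car A) w"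
    let ?Xs = "map2 (quot_proj \<Phi>) w xs"
    have eqv: "equiv (Car A t) (\<Phi> t)" if "t \<in> S" for t
      by (rule congruence_equiv[OF \<Phi> that])
    have Xs: "?Xs \<in> word_prod (\<lambda>s\<in>S. Car A s // \<Phi> s) w"
      using xs opsyms_nth[OF p]
      by (auto simp: word_prod_def quot_proj_def intro!: quotientI)
    \<comment> \<open>The quotient operation is a union over all tuples of representatives.
      Compatibility makes every member of the union the same class, and \<open>xs\<close> itself is
      a tuple of representatives, so the union is not empty.\<close>
    have reps: "\<Phi> s `` {Opn A (w, s, \<sigma>) ys} = \<Phi> s `` {Opn A (w, s, \<sigma>) xs}"
      if "list_all2 (\<in>) ys ?Xs" for ys
    proof -
      from that xs have len: "length ys = length w"
        by (auto simp: list_all2_conv_all_nth word_prod_def)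
      have r: "(xs ! i, ys ! i) \<in> \<Phi> (w ! i)" if "i < length w" for i
        using \<open>list_all2 (\<in>) ys ?Xs\<close> that xs
        by (auto simp: list_all2_conv_all_nth word_prod_def quot_proj_def)
      have "ys \<in> word_prod (Car A) w"
        using len r eqv opsyms_nth[OF p] unfolding word_prod_def equiv_def by blast
      then have "(Opn A (w, s, \<sigma>) xs, Opn A (w, s, \<sigma>) ys) \<in> \<Phi> s"
        using congruence_Opn[OF \<Phi> p xs] r by blast
      then show ?thesis
        using equiv_class_eq[OF eqv] opsyms_sort[OF p] by metis
    qed
    have "list_all2 (\<in>) xs ?Xs"
      using xs equiv_class_self[OF eqv] opsyms_nth[OF p]
      by (auto simp: list_all2_conv_all_nth word_prod_def quot_proj_def)
    with reps have "(\<Union>ys\<in>{ys. list_all2 (\<in>) ys ?Xs}. \<Phi> s `` {Opn A (w, s, \<sigma>) ys})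
        = \<Phi> s `` {Opn A (w, s, \<sigma>) xs}"
      by blast
    then show "quot_proj \<Phi> s (Opn A (w, s, \<sigma>) xs)
        = Opn (quot_algebra S \<Sigma> A \<Phi>) (w, s, \<sigma>) ?Xs"
      using Xs p by (simp add: quot_algebra_def quot_proj_def Let_def)
  qed
  then show ?thesis
    using im by (simp add: sepi_def)
qed

text \<open>Here \<open>f\<close> is a bare family of maps with no structure on its target. An
  operation on the image is computed on preimages chosen by \<open>inv_into\<close>, and the
  congruence property of the kernel makes the choice irrelevant. It serves to give operations to the
  image of a quotient under arbitrary sortwise injections.\<close>

lemma image_algebra:
  assumes A: "is_algebra S \<Sigma> A" and K: "Ker S A f \<in> congruences S \<Sigma> A"
  obtains C where "is_algebra S \<Sigma> C" "Car C = (\<lambda>s\<in>S. f s ` Car A s)" "f \<in> sepi S \<Sigma> A C"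
proof -
  define P where "P = (\<lambda>s\<in>S. f s ` Car A s)"
  define r where "r = (\<lambda>s. inv_into (Car A s) (f s))"
  define C where "C = \<lparr>Car = P,
    Opn = (\<lambda>(w, s, \<sigma>)\<in>opsyms S \<Sigma>. \<lambda>ys\<in>word_prod P w. f s (Opn A (w, s, \<sigma>) (map2 r w ys)))\<rparr>"
  have r: "r s y \<in> Car A s" "f s (r s y) = y" if "s \<in> S" "y \<in> P s" for s y
    using that by (auto simp: P_def r_def intro: inv_into_into f_inv_into_f)
  have rw: "map2 r w ys \<in> word_prod (Car A) w"
    if "(w, s, \<sigma>) \<in> opsyms S \<Sigma>" "ys \<in> word_prod P w" for w s \<sigma> ys
    using r opsyms_nth[OF that(1)] by (intro word_prod_map2[OF that(2)]) auto
  have alg: "is_algebra S \<Sigma> C"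
    unfolding C_def
  proof (rule is_algebraI)
    show "f s (Opn A (w, s, \<sigma>) (map2 r w ys)) \<in> P s"
      if "(w, s, \<sigma>) \<in> opsyms S \<Sigma>" "ys \<in> word_prod P w" for w s \<sigma> ys
      using algebra_closed[OF A that(1) rw[OF that]] opsyms_sort[OF that(1)] by (simp add: P_def)
  qed (simp add: P_def)
  have "f \<in> shom S \<Sigma> A C"
  proof (rule shomI)
    show "f s x \<in> Car C s" if "s \<in> S" "x \<in> Car A s" for s x
      using that by (simp add: C_def P_def)
  next
    fix w s \<sigma> xs assume p: "(w, s, \<sigma>) \<in> opsyms S \<Sigma>" and xs: "xs \<in> word_prod (Car A) w"
    have fw: "map2 f w xs \<in> word_prod P w"
      using opsyms_nth[OF p] by (intro word_prod_map2[OF xs]) (auto simp: P_def)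
    \<comment> \<open>A tuple and the chosen preimages of its image are componentwise congruent, so
      applying the operation to either gives the same value under \<open>f\<close>.\<close>
    have "(xs ! i, map2 r w (map2 f w xs) ! i) \<in> Ker S A f (w ! i)" if "i < length w" for i
    proof -
      have "w ! i \<in> S" "xs ! i \<in> Car A (w ! i)" "length xs = length w"
        using that xs opsyms_nth[OF p] by (auto simp: word_prod_def)
      then show ?thesis
        using that r[of "w ! i" "f (w ! i) (xs ! i)"] by (simp add: Ker_iff P_def)
    qed
    from congruence_Opn[OF K p xs rw[OF p fw] this]
    show "f s (Opn A (w, s, \<sigma>) xs) = Opn C (w, s, \<sigma>) (map2 f w xs)"
      using p fw by (simp add: C_def Ker_iff opsyms_sort[OF p])
  qed
  then have "f \<in> sepi S \<Sigma> A C"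
    by (simp add: sepi_def C_def P_def)
  with alg show thesis
    by (intro that) (simp_all add: C_def P_def)
qed

text \<open>The homomorphism theorem: \<open>h\<close> applies \<open>g\<close> to a chosen preimage
  under \<open>f\<close>, and the inclusion of kernels makes the result independent of the choice.
  It yields epimorphisms between algebras presented by one and the same free algebra.\<close>

lemma sepi_factor:
  assumes A: "is_algebra S \<Sigma> A"
    and f: "f \<in> sepi S \<Sigma> A B" and g: "g \<in> sepi S \<Sigma> A C"
    and le: "cgr_le S (Ker S A f) (Ker S A g)"
  obtains h where "h \<in> sepi S \<Sigma> B C" "\<And>s x. s \<in> S \<Longrightarrow> x \<in> Car A s \<Longrightarrow> h s (f s x) = g s x"
proof -
  define r where "r = (\<lambda>s. inv_into (Car A s) (f s))"
  define h where "h = (\<lambda>s y. g s (r s y))"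
  note gc = shom_closed[OF sepi_shom[OF g]] and fc = shom_closed[OF sepi_shom[OF f]]
  have r: "r s y \<in> Car A s" "f s (r s y) = y" if "s \<in> S" "y \<in> Car B s" for s y
    using that sepi_image[OF f] unfolding r_def by (metis inv_into_into, metis f_inv_into_f)
  have hf: "h s (f s x) = g s x" if "s \<in> S" "x \<in> Car A s" for s x
  proof -
    have "(r s (f s x), x) \<in> Ker S A f s"
      using that r fc by (simp add: Ker_iff)
    then have "(r s (f s x), x) \<in> Ker S A g s"
      using le that by (auto simp: cgr_le_def)
    then show ?thesis using that by (simp add: Ker_iff h_def)
  qed
  have "h \<in> shom S \<Sigma> B C"
  proof (rule shomI)
    show "h s y \<in> Car C s" if "s \<in> S" "y \<in> Car B s" for s y
      using that r gc by (simp add: h_def)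
  next
    fix w s \<sigma> ys assume p: "(w, s, \<sigma>) \<in> opsyms S \<Sigma>" and ys: "ys \<in> word_prod (Car B) w"
    let ?xs = "map2 r w ys"
    have xs: "?xs \<in> word_prod (Car A) w"
      using r opsyms_nth[OF p] by (intro word_prod_map2[OF ys]) auto
    have "map2 f w ?xs = ys"
      using ys r opsyms_nth[OF p] by (intro nth_equalityI) (auto simp: word_prod_def)
    moreover have "map2 g w ?xs = map2 h w ys"
      using ys by (intro nth_equalityI) (auto simp: word_prod_def h_def)
    ultimately have "h s (f s (Opn A (w, s, \<sigma>) ?xs)) = h s (Opn B (w, s, \<sigma>) ys)"
      "g s (Opn A (w, s, \<sigma>) ?xs) = Opn C (w, s, \<sigma>) (map2 h w ys)"
      by (simp_all add: shom_Opn[OF sepi_shom[OF f] p xs] shom_Opn[OF sepi_shom[OF g] p xs])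
    then show "h s (Opn B (w, s, \<sigma>) ys) = Opn C (w, s, \<sigma>) (map2 h w ys)"
      using hf[OF opsyms_sort[OF p] algebra_closed[OF A p xs]] by simp
  qed
  moreover have "h s ` Car B s = Car C s" if "s \<in> S" for s
    using hf[OF that] sepi_image[OF f that, symmetric] sepi_image[OF g that, symmetric]
    by (auto simp: image_image)
  ultimately have "h \<in> sepi S \<Sigma> B C"
    by (simp add: sepi_def)
  then show thesis
    using hf by (rule that)
qed

section \<open>Free algebras\<close>

lemma Car_free: "s \<in> S \<Longrightarrow> t \<in> Car (free_algebra S \<Sigma> A) s \<longleftrightarrow> well_sorted S \<Sigma> A s t"
  by (simp add: free_algebra_def Let_def)

lemma Opn_free:
  "(w, s, \<sigma>) \<in> opsyms S \<Sigma> \<Longrightarrow> ts \<in> word_prod (Car (free_algebra S \<Sigma> A)) w \<Longrightarrow>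
    Opn (free_algebra S \<Sigma> A) (w, s, \<sigma>) ts = App (w, s, \<sigma>) ts"
  by (simp add: free_algebra_def Let_def)

lemma word_prod_free:
  assumes "(w, s, \<sigma>) \<in> opsyms S \<Sigma>"
  shows "ts \<in> word_prod (Car (free_algebra S \<Sigma> A)) w \<longleftrightarrow>
    length ts = length w \<and> (\<forall>i<length w. well_sorted S \<Sigma> A (w ! i) (ts ! i))"
  using opsyms_nth[OF assms] by (auto simp: word_prod_def Car_free)

lemma free_is_algebra: "is_algebra S \<Sigma> (free_algebra S \<Sigma> A)"
  unfolding free_algebra_def Let_def
proof (rule is_algebraI)
  fix w s \<sigma> ts
  assume p: "(w, s, \<sigma>) \<in> opsyms S \<Sigma>"
    and ts: "ts \<in> word_prod (\<lambda>s\<in>S. {t. well_sorted S \<Sigma> A s t}) w"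
  have "well_sorted S \<Sigma> A s (App (w, s, \<sigma>) ts)"
    using ts opsyms_nth[OF p] by (intro well_sorted.app[OF p]) (auto simp: word_prod_def)
  with p show "App (w, s, \<sigma>) ts \<in> (\<lambda>s\<in>S. {t. well_sorted S \<Sigma> A s t}) s"
    by (simp add: opsyms_sort[OF p])
qed simp

text \<open>Variables and operation symbols carry their sorts, so a single unsorted function
  evaluates terms of every sort; the induced homomorphism is the family constant in the
  sort.\<close>

primrec term_eval ::
    "('s, 'f, 'b) salgebra \<Rightarrow> ('s \<Rightarrow> 'a \<Rightarrow> 'b) \<Rightarrow> ('s, 'f, 'a) trm \<Rightarrow> 'b" where
  "term_eval B v (Var s a) = v s a"
| "term_eval B v (App p ts) = Opn B p (map (term_eval B v) ts)"

lemma free_hom_exists: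
  assumes B: "is_algebra S \<Sigma> B" and v: "\<And>s a. s \<in> S \<Longrightarrow> a \<in> A s \<Longrightarrow> v s a \<in> Car B s"
  shows "(\<lambda>_. term_eval B v) \<in> shom S \<Sigma> (free_algebra S \<Sigma> A) B"
proof (rule shomI)
  fix s t assume "s \<in> S" "t \<in> Car (free_algebra S \<Sigma> A) s"
  then have "well_sorted S \<Sigma> A s t" by (simp add: Car_free)
  then show "term_eval B v t \<in> Car B s"
  proof induction
    case (app w s \<sigma> ts)
    then have "map (term_eval B v) ts \<in> word_prod (Car B) w"
      by (auto simp: word_prod_def)
    with app show ?case by (simp add: algebra_closed[OF B])
  qed (simp add: v)
next
  fix w s \<sigma> ts
  assume p: "(w, s, \<sigma>) \<in> opsyms S \<Sigma>" and ts: "ts \<in> word_prod (Car (free_algebra S \<Sigma> A)) w"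
  then have "map (term_eval B v) ts = map2 (\<lambda>_. term_eval B v) w ts"
    by (intro nth_equalityI) (auto simp: word_prod_def)
  then show "term_eval B v (Opn (free_algebra S \<Sigma> A) (w, s, \<sigma>) ts)
      = Opn B (w, s, \<sigma>) (map2 (\<lambda>_. term_eval B v) w ts)"
    by (simp add: Opn_free[OF p ts])
qed

lemma free_hom_unique:
  assumes f: "f \<in> shom S \<Sigma> (free_algebra S \<Sigma> A) B" and g: "g \<in> shom S \<Sigma> (free_algebra S \<Sigma> A) B"
    and eq: "\<And>s a. s \<in> S \<Longrightarrow> a \<in> A s \<Longrightarrow> f s (Var s a) = g s (Var s a)"
    and s: "s \<in> S" and t: "t \<in> Car (free_algebra S \<Sigma> A) s"
  shows "f s t = g s t"
proof -
  from s t have "well_sorted S \<Sigma> A s t" by (simp add: Car_free)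
  then show ?thesis
  proof induction
    case (app w s \<sigma> ts)
    then have ts: "ts \<in> word_prod (Car (free_algebra S \<Sigma> A)) w"
      by (simp add: word_prod_free)
    have "map2 f w ts = map2 g w ts"
      using app by (intro nth_equalityI) auto
    with shom_Opn[OF f app(1) ts] shom_Opn[OF g app(1) ts] show ?case
      by (simp add: Opn_free[OF app(1) ts])
  qed (simp add: eq)
qed

text \<open>A preimage under \<open>g\<close> is chosen for the image of each variable only, and
  freeness extends the choice to all terms. The maps \<open>f\<close> and \<open>g\<close> after
  \<open>h\<close> agree on variables, hence everywhere.\<close>

lemma free_projective:
  assumes C: "is_algebra S \<Sigma> C"
    and f: "f \<in> shom S \<Sigma> (free_algebra S \<Sigma> A) B" and g: "g \<in> sepi S \<Sigma> C B"
  obtains h where "h \<in> shom S \<Sigma> (free_algebra S \<Sigma> A) C"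
    "\<And>s t. s \<in> S \<Longrightarrow> t \<in> Car (free_algebra S \<Sigma> A) s \<Longrightarrow> g s (h s t) = f s t"
proof -
  define v where "v = (\<lambda>s a. inv_into (Car C s) (g s) (f s (Var s a)))"
  have v: "v s a \<in> Car C s" "g s (v s a) = f s (Var s a)" if "s \<in> S" "a \<in> A s" for s a
  proof -
    have "f s (Var s a) \<in> g s ` Car C s"
      using that shom_closed[OF f] sepi_image[OF g] by (auto simp: Car_free well_sorted.var)
    then show "v s a \<in> Car C s" "g s (v s a) = f s (Var s a)"
      by (auto simp: v_def inv_into_into f_inv_into_f)
  qed
  have h: "(\<lambda>_. term_eval C v) \<in> shom S \<Sigma> (free_algebra S \<Sigma> A) C"
    by (rule free_hom_exists[OF C v(1)])
  have "g s (term_eval C v t) = f s t" if "s \<in> S" "t \<in> Car (free_algebra S \<Sigma> A) s" for s t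
    using free_hom_unique[OF shom_comp[OF h sepi_shom[OF g]] f _ that] v(2)
    by (simp add: scomp_def)
  with h show thesis by (rule that)
qed

text \<open>Evaluation under the identity valuation is onto because every element is already the
  value of a variable.\<close>

lemma free_onto:
  assumes "is_algebra S \<Sigma> B"
  obtains e where "e \<in> sepi S \<Sigma> (free_algebra S \<Sigma> (Car B)) B"
proof -
  have h: "(\<lambda>_. term_eval B (\<lambda>_ a. a)) \<in> shom S \<Sigma> (free_algebra S \<Sigma> (Car B)) B"
    by (rule free_hom_exists[OF assms])
  have "term_eval B (\<lambda>_ a. a) ` Car (free_algebra S \<Sigma> (Car B)) s = Car B s" if s: "s \<in> S" for s
  proof
    show "Car B s \<subseteq> term_eval B (\<lambda>_ a. a) ` Car (free_algebra S \<Sigma> (Car B)) s"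
    proof
      fix b assume "b \<in> Car B s"
      then have "Var s b \<in> Car (free_algebra S \<Sigma> (Car B)) s"
        using s by (simp add: Car_free well_sorted.var)
      then show "b \<in> term_eval B (\<lambda>_ a. a) ` Car (free_algebra S \<Sigma> (Car B)) s"
        by (force intro: image_eqI[where x = "Var s b"])
    qed
  qed (use shom_closed[OF h s] in blast)
  with h have "(\<lambda>_. term_eval B (\<lambda>_ a. a)) \<in> sepi S \<Sigma> (free_algebra S \<Sigma> (Car B)) B"
    by (simp add: sepi_def)
  then show thesis by (rule that)
qed

section \<open>Subdirect embeddings\<close>

lemma Car_prod: "s \<in> S \<Longrightarrow> Car (prod_algebra S \<Sigma> I C) s = (\<Pi>\<^sub>E i\<in>I. Car (C i) s)"
  by (simp add: prod_algebra_def Let_def)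

lemma Opn_prod:
  "(w, s, \<sigma>) \<in> opsyms S \<Sigma> \<Longrightarrow> gs \<in> word_prod (Car (prod_algebra S \<Sigma> I C)) w \<Longrightarrow>
    Opn (prod_algebra S \<Sigma> I C) (w, s, \<sigma>) gs = (\<lambda>i\<in>I. Opn (C i) (w, s, \<sigma>) (map (\<lambda>g. g i) gs))"
  by (simp add: prod_algebra_def Let_def)

lemma subdirect_PiE:
  assumes f: "subdirect_embedding S \<Sigma> A I C f" and "s \<in> S" "x \<in> Car A s"
  shows "f s x \<in> (\<Pi>\<^sub>E i\<in>I. Car (C i) s)"
proof -
  from f have "f \<in> shom S \<Sigma> A (prod_algebra S \<Sigma> I C)"
    by (simp add: subdirect_embedding_def)
  from shom_closed[OF this assms(2,3)] show ?thesis
    using assms(2) by (simp add: Car_prod)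
qed

lemma subdirect_component:
  assumes f: "subdirect_embedding S \<Sigma> A I C f" and i: "i \<in> I"
  shows "(\<lambda>s x. f s x i) \<in> sepi S \<Sigma> A (C i)"
proof -
  from f have h: "f \<in> shom S \<Sigma> A (prod_algebra S \<Sigma> I C)"
    and im: "\<And>s. s \<in> S \<Longrightarrow> (\<lambda>x. f s x i) ` Car A s = Car (C i) s"
    using i by (auto simp: subdirect_embedding_def)
  have "(\<lambda>s x. f s x i) \<in> shom S \<Sigma> A (C i)"
  proof (rule shomI)
    show "f s x i \<in> Car (C i) s" if "s \<in> S" "x \<in> Car A s" for s x
      using im that by blast
  next
    fix w s \<sigma> xs assume p: "(w, s, \<sigma>) \<in> opsyms S \<Sigma>" "xs \<in> word_prod (Car A) w"
    have "map (\<lambda>g. g i) (map2 f w xs) = map2 (\<lambda>s x. f s x i) w xs"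
      by (auto simp: comp_def case_prod_unfold)
    then show "f s (Opn A (w, s, \<sigma>) xs) i = Opn (C i) (w, s, \<sigma>) (map2 (\<lambda>s x. f s x i) w xs)"
      using i by (simp only: shom_Opn[OF h p] Opn_prod[OF p(1) shom_word_prod[OF h p]] restrict_apply'
          if_True)
  qed
  with im show ?thesis by (simp add: sepi_def)
qed

lemma subdirect_embeddingI:
  assumes A: "is_algebra S \<Sigma> A" and h: "\<And>i. i \<in> I \<Longrightarrow> h i \<in> sepi S \<Sigma> A (C i)"
    and inj: "\<And>s x y. s \<in> S \<Longrightarrow> x \<in> Car A s \<Longrightarrow> y \<in> Car A s \<Longrightarrow>
      (\<And>i. i \<in> I \<Longrightarrow> h i s x = h i s y) \<Longrightarrow> x = y"
  shows "subdirect_embedding S \<Sigma> A I C (\<lambda>s x. \<lambda>i\<in>I. h i s x)" (is "subdirect_embedding _ _ _ _ _ ?f")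
proof -
  have fc: "?f s x \<in> Car (prod_algebra S \<Sigma> I C) s" if "s \<in> S" "x \<in> Car A s" for s x
    using that h by (auto simp: Car_prod dest: sepi_shom shom_closed)
  have "?f \<in> shom S \<Sigma> A (prod_algebra S \<Sigma> I C)"
  proof (rule shomI[OF fc])
    fix w s \<sigma> xs assume p: "(w, s, \<sigma>) \<in> opsyms S \<Sigma>" and xs: "xs \<in> word_prod (Car A) w"
    have "map2 ?f w xs \<in> word_prod (Car (prod_algebra S \<Sigma> I C)) w"
      using fc opsyms_nth[OF p] by (intro word_prod_map2[OF xs]) auto
    moreover have "map (\<lambda>g. g i) (map2 ?f w xs) = map2 (h i) w xs" if "i \<in> I" for i
      using that by (auto simp: comp_def case_prod_unfold)
    ultimately show "?f s (Opn A (w, s, \<sigma>) xs)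
        = Opn (prod_algebra S \<Sigma> I C) (w, s, \<sigma>) (map2 ?f w xs)"
      using shom_Opn[OF sepi_shom[OF h] p xs]
      by (simp only: Opn_prod[OF p]) (intro restrict_ext, simp only:)
  qed
  moreover have "inj_on (?f s) (Car A s)" if "s \<in> S" for s
  proof (rule inj_onI)
    fix x y assume xy: "x \<in> Car A s" "y \<in> Car A s" "?f s x = ?f s y"
    then have "h i s x = h i s y" if "i \<in> I" for i
      using that by (metis restrict_apply')
    with xy inj[OF \<open>s \<in> S\<close>] show "x = y" by blast
  qed
  moreover have "(\<lambda>x. ?f s x i) ` Car A s = Car (C i) s" if "i \<in> I" "s \<in> S" for i s
    using that sepi_image[OF h[OF that(1)]] by simp
  ultimately show ?thesis by (simp add: subdirect_embedding_def)
qed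

section \<open>Transfer of completeness\<close>

lemma partial_orderI:
  assumes "eq L = (=)"
    and "\<And>x. x \<in> carrier L \<Longrightarrow> le L x x"
    and "\<And>x y. x \<in> carrier L \<Longrightarrow> y \<in> carrier L \<Longrightarrow> le L x y \<Longrightarrow> le L y x \<Longrightarrow> x = y"
    and "\<And>x y z. x \<in> carrier L \<Longrightarrow> y \<in> carrier L \<Longrightarrow> z \<in> carrier L \<Longrightarrow>
      le L x y \<Longrightarrow> le L y z \<Longrightarrow> le L x z"
  shows "partial_order L"
proof (unfold_locales, unfold assms(1))
  show "le L x z" if "le L x y" "le L y z" "x \<in> carrier L" "y \<in> carrier L" "z \<in> carrier L" for x y z
    using that by (blast intro: assms(4))
qed (simp_all add: assms(2,3))

text \<open>Under an order isomorphism the bounds of an image are the images of the bounds, so least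
  and greatest elements are carried along. This moves completeness from the side of algebras, where
  infima are plain intersections, to the side of congruences.\<close>

lemma complete_lattice_transfer:
  assumes L: "complete_lattice L" and M: "partial_order M"
    and bij: "bij_betw h (carrier L) (carrier M)" and emb: "order_emb L M h"
  shows "complete_lattice M"
proof -
  interpret L: complete_lattice L by (rule L)
  interpret M: partial_order M by (rule M)
  have le: "le M (h x) (h y) \<longleftrightarrow> le L x y" if "x \<in> carrier L" "y \<in> carrier L" for x y
    using emb that by (auto simp: order_emb_def)
  have car: "carrier M = h ` carrier L"
    using bij by (simp add: bij_betw_def)
  have up: "Upper M (h ` X) = h ` Upper L X" and low: "Lower M (h ` X) = h ` Lower L X"
    if X: "X \<subseteq> carrier L" for X
  proof -
    have "Upper M (h ` X) = {u \<in> h ` carrier L. \<forall>x\<in>X. le M (h x) u}"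
      "Lower M (h ` X) = {u \<in> h ` carrier L. \<forall>x\<in>X. le M u (h x)}"
      using X by (auto simp: Upper_def Lower_def car)
    moreover have "Upper L X = {u \<in> carrier L. \<forall>x\<in>X. le L x u}"
      "Lower L X = {u \<in> carrier L. \<forall>x\<in>X. le L u x}"
      using X by (auto simp: Upper_def Lower_def)
    ultimately show "Upper M (h ` X) = h ` Upper L X" "Lower M (h ` X) = h ` Lower L X"
      using X le by (auto simp: subset_iff)
  qed
  have least: "least M (h x) (h ` X)" if "least L x X" for x X
    using that by (auto simp: least_def car le subset_iff)
  have greatest: "greatest M (h x) (h ` X)" if "greatest L x X" for x X
    using that by (auto simp: greatest_def car le subset_iff)
  show ?thesis
  proof
    fix Y assume "Y \<subseteq> carrier M"
    then obtain X where X: "X \<subseteq> carrier L" "Y = h ` X"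
      unfolding car by (auto simp: subset_image_iff)
    show "\<exists>s. least M s (Upper M Y)"
      using L.sup_exists[OF X(1)] least X by (auto simp: up)
    show "\<exists>i. greatest M i (Lower M Y)"
      using L.inf_exists[OF X(1)] greatest X by (auto simp: low)
  qed
qed

section \<open>Formations\<close>

lemma algebra_formation_Alg: "algebra_formation U S \<Sigma> F \<Longrightarrow> F \<subseteq> Alg U S \<Sigma>"
  unfolding algebra_formation_def by (rule conjunct1)

lemma algebra_formation_epi:
  "algebra_formation U S \<Sigma> F \<Longrightarrow> B \<in> F \<Longrightarrow> A \<in> Alg U S \<Sigma> \<Longrightarrow> f \<in> sepi S \<Sigma> B A \<Longrightarrow> A \<in> F"
  unfolding algebra_formation_def by blast

lemma algebra_formationI:
  assumes "F \<subseteq> Alg U S \<Sigma>" "F \<noteq> {}"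
    and epi: "\<And>A B f. B \<in> F \<Longrightarrow> A \<in> Alg U S \<Sigma> \<Longrightarrow> f \<in> sepi S \<Sigma> B A \<Longrightarrow> A \<in> F"
    and "\<And>(n::nat) C A f. A \<in> Alg U S \<Sigma> \<Longrightarrow> (\<And>i. i < n \<Longrightarrow> C i \<in> F) \<Longrightarrow>
      subdirect_embedding S \<Sigma> A {..<n} C f \<Longrightarrow> A \<in> F"
  shows "algebra_formation U S \<Sigma> F"
  unfolding algebra_formation_def
proof (intro conjI ballI allI impI)
  show "A \<in> F" if "B \<in> F" "A \<in> Alg U S \<Sigma>" "siso S \<Sigma> B A \<noteq> {}" for A B
    using that epi siso_sepi by blast
qed (use assms in blast)+

text \<open>Epimorphisms that jointly separate points assemble into a subdirect embedding, so
  condition (4) can be applied without mentioning products. For \<open>n = 0\<close> this covers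
  every algebra with at most one element in each sort, possibly none.\<close>

lemma algebra_formation_subdirect:
  fixes n :: nat
  assumes F: "algebra_formation U S \<Sigma> F" and A: "A \<in> Alg U S \<Sigma>"
    and C: "\<And>i. i < n \<Longrightarrow> C i \<in> F" and h: "\<And>i. i < n \<Longrightarrow> h i \<in> sepi S \<Sigma> A (C i)"
    and inj: "\<And>s x y. s \<in> S \<Longrightarrow> x \<in> Car A s \<Longrightarrow> y \<in> Car A s \<Longrightarrow>
      (\<And>i. i < n \<Longrightarrow> h i s x = h i s y) \<Longrightarrow> x = y"
  shows "A \<in> F"
proof -
  have "subdirect_embedding S \<Sigma> A {..<n} C (\<lambda>s x. \<lambda>i\<in>{..<n}. h i s x)"
    using A h inj by (intro subdirect_embeddingI) (auto simp: Alg_def)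
  with F A C show ?thesis
    unfolding algebra_formation_def by blast
qed

text \<open>Stands for the condition that the quotient by \<open>\<Phi>\<close> belongs to
  \<open>F\<close>. That quotient has sets of terms as elements, so an isomorphic copy
  \<open>B\<close> in \<open>F\<close> takes its place.\<close>

definition formation_congruences ::
    "'a set set \<Rightarrow> 's set \<Rightarrow> ('s list \<Rightarrow> 's \<Rightarrow> 'f set) \<Rightarrow> ('s, 'f, 'a) salgebra set
      \<Rightarrow> ('s, 'f, 'a) cgr_family" where
  "formation_congruences U S \<Sigma> F = (\<lambda>A\<in>sorted_sets U S.
     {\<Phi>. \<exists>B\<in>F. \<exists>f\<in>sepi S \<Sigma> (free_algebra S \<Sigma> A) B. \<Phi> = Ker S (free_algebra S \<Sigma> A) f})"

definition formation_algebras ::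
    "'a set set \<Rightarrow> 's set \<Rightarrow> ('s list \<Rightarrow> 's \<Rightarrow> 'f set) \<Rightarrow> ('s, 'f, 'a) cgr_family
      \<Rightarrow> ('s, 'f, 'a) salgebra set" where
  "formation_algebras U S \<Sigma> G = {B \<in> Alg U S \<Sigma>.
     \<exists>A\<in>sorted_sets U S. \<exists>f\<in>sepi S \<Sigma> (free_algebra S \<Sigma> A) B. Ker S (free_algebra S \<Sigma> A) f \<in> G A}"

lemma formation_congruences_iff:
  "A \<in> sorted_sets U S \<Longrightarrow> \<Phi> \<in> formation_congruences U S \<Sigma> F A \<longleftrightarrow>
    (\<exists>B\<in>F. \<exists>f\<in>sepi S \<Sigma> (free_algebra S \<Sigma> A) B. \<Phi> = Ker S (free_algebra S \<Sigma> A) f)"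
  by (simp add: formation_congruences_def)

lemma formation_algebrasI:
  "B \<in> Alg U S \<Sigma> \<Longrightarrow> A \<in> sorted_sets U S \<Longrightarrow> f \<in> sepi S \<Sigma> (free_algebra S \<Sigma> A) B \<Longrightarrow>
    Ker S (free_algebra S \<Sigma> A) f \<in> G A \<Longrightarrow> B \<in> formation_algebras U S \<Sigma> G"
  unfolding formation_algebras_def by blast

lemma formation_algebrasE:
  assumes "B \<in> formation_algebras U S \<Sigma> G"
  obtains A f where "B \<in> Alg U S \<Sigma>" "A \<in> sorted_sets U S"
    "f \<in> sepi S \<Sigma> (free_algebra S \<Sigma> A) B" "Ker S (free_algebra S \<Sigma> A) f \<in> G A"
  using assms unfolding formation_algebras_def by blast

lemma congruence_formation_extensional:
  "congruence_formation U S \<Sigma> G \<Longrightarrow> G \<in> extensional (sorted_sets U S)"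
  unfolding congruence_formation_def by (rule conjunct1)

lemma congruence_formation_filter:
  "congruence_formation U S \<Sigma> G \<Longrightarrow> A \<in> sorted_sets U S \<Longrightarrow> cgr_filter S \<Sigma> (free_algebra S \<Sigma> A) (G A)"
  by (simp add: congruence_formation_def)

text \<open>
  By projectivity of free algebras, condition (2) in the definition of a formation of congruences
  makes membership of a kernel depend on the codomain of the epimorphism only.
\<close>

lemma congruence_formation_transport:
  assumes G: "congruence_formation U S \<Sigma> G"
    and A: "A \<in> sorted_sets U S" and A': "A' \<in> sorted_sets U S"
    and f: "f \<in> sepi S \<Sigma> (free_algebra S \<Sigma> A) B" and K: "Ker S (free_algebra S \<Sigma> A) f \<in> G A"
    and g: "g \<in> sepi S \<Sigma> (free_algebra S \<Sigma> A') B"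
  shows "Ker S (free_algebra S \<Sigma> A') g \<in> G A'"
proof -
  let ?T = "free_algebra S \<Sigma> A" and ?T' = "free_algebra S \<Sigma> A'"
  let ?\<Theta> = "Ker S ?T f"
  obtain h where h: "h \<in> shom S \<Sigma> ?T' ?T"
    and fh: "\<And>s t. s \<in> S \<Longrightarrow> t \<in> Car ?T' s \<Longrightarrow> f s (h s t) = g s t"
    by (rule free_projective[OF free_is_algebra sepi_shom[OF g] f]) blast
  have \<Theta>: "?\<Theta> \<in> congruences S \<Sigma> ?T"
    by (rule Ker_congruence[OF free_is_algebra sepi_shom[OF f]])
  have q: "quot_proj ?\<Theta> \<in> sepi S \<Sigma> ?T (quot_algebra S \<Sigma> ?T ?\<Theta>)"
    by (rule quot_proj_sepi[OF free_is_algebra \<Theta>])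
  note qeq = quot_proj_Ker_eq_iff[OF free_is_algebra sepi_shom[OF f]]
  \<comment> \<open>The lift \<open>h\<close> need not be onto. Modulo \<open>?\<Theta>\<close> it
    is, since \<open>g\<close> reaches every value of \<open>f\<close>, and this is exactly what
    condition (2) requires.\<close>
  have "quot_proj ?\<Theta> s ` h s ` Car ?T' s = quot_proj ?\<Theta> s ` Car ?T s" if s: "s \<in> S" for s
  proof
    show "quot_proj ?\<Theta> s ` h s ` Car ?T' s \<subseteq> quot_proj ?\<Theta> s ` Car ?T s"
      using shom_closed[OF h s] by blast
    show "quot_proj ?\<Theta> s ` Car ?T s \<subseteq> quot_proj ?\<Theta> s ` h s ` Car ?T' s"
    proof
      fix X assume "X \<in> quot_proj ?\<Theta> s ` Car ?T s"
      then obtain x where x: "x \<in> Car ?T s" "X = quot_proj ?\<Theta> s x" by blast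
      then have "f s x \<in> g s ` Car ?T' s"
        using shom_closed[OF sepi_shom[OF f] s] sepi_image[OF g s] by blast
      then obtain t where t: "t \<in> Car ?T' s" "f s x = f s (h s t)"
        using fh[OF s] by auto
      then have "X = quot_proj ?\<Theta> s (h s t)"
        using qeq[OF s x(1) shom_closed[OF h s t(1)]] x(2) by simp
      with t(1) show "X \<in> quot_proj ?\<Theta> s ` h s ` Car ?T' s" by blast
    qed
  qed
  then have "scomp (quot_proj ?\<Theta>) h \<in> sepi S \<Sigma> ?T' (quot_algebra S \<Sigma> ?T ?\<Theta>)"
    using shom_comp[OF h sepi_shom[OF q]] sepi_image[OF q]
    by (simp add: sepi_def scomp_def image_image)
  then have "Ker S ?T' (scomp (quot_proj ?\<Theta>) h) \<in> G A'"
    using G A A' h K unfolding congruence_formation_def by blast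
  moreover have "Ker S ?T' (scomp (quot_proj ?\<Theta>) h) = Ker S ?T' g"
  proof (rule extensionalityI[OF Ker_extensional Ker_extensional])
    show "Ker S ?T' (scomp (quot_proj ?\<Theta>) h) s = Ker S ?T' g s" if s: "s \<in> S" for s
      using shom_closed[OF h s] qeq[OF s] fh[OF s] by (auto simp: Ker_iff[OF s] scomp_def)
  qed
  ultimately show ?thesis by simp
qed

section \<open>Finite intersections in filters and finiteness of quotients\<close>

lemma cgr_filter_upward:
  "cgr_filter S \<Sigma> A X \<Longrightarrow> \<Phi> \<in> X \<Longrightarrow> \<Psi> \<in> congruences S \<Sigma> A \<Longrightarrow> cgr_le S \<Phi> \<Psi> \<Longrightarrow> \<Psi> \<in> X"
  unfolding cgr_filter_def by blast

text \<open>The explicit factor \<open>Car A s \<times> Car A s\<close> matters for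
  \<open>n = 0\<close>, where the bare intersection would be the universal relation on the whole
  type. The full congruence lies in \<open>X\<close> because \<open>X\<close> is nonempty and upward
  closed.\<close>

lemma cgr_filter_Inter:
  assumes X: "cgr_filter S \<Sigma> A X" and A: "is_algebra S \<Sigma> A" and K: "\<And>i::nat. i < n \<Longrightarrow> K i \<in> X"
  shows "(\<lambda>s\<in>S. Car A s \<times> Car A s \<inter> (\<Inter>i<n. K i s)) \<in> X"
  using K
proof (induction n)
  case 0
  from X obtain \<Phi> where \<Phi>: "\<Phi> \<in> X" "\<Phi> \<in> congruences S \<Sigma> A"
    unfolding cgr_filter_def by blast
  then have "cgr_le S \<Phi> (\<lambda>s\<in>S. Car A s \<times> Car A s)"
    unfolding cgr_le_def by (auto dest: congruence_equiv equivE simp: equiv_def refl_on_def)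
  with cgr_filter_upward[OF X \<Phi>(1) full_congruence[OF A]] show ?case
    by (simp add: restrict_def)
next
  case (Suc n)
  have "cgr_inter S (\<lambda>s\<in>S. Car A s \<times> Car A s \<inter> (\<Inter>i<n. K i s)) (K n) \<in> X"
    using Suc.IH[OF Suc.prems[OF less_SucI]] Suc.prems[OF lessI] X unfolding cgr_filter_def by blast
  moreover have "cgr_inter S (\<lambda>s\<in>S. Car A s \<times> Car A s \<inter> (\<Inter>i<n. K i s)) (K n)
      = (\<lambda>s\<in>S. Car A s \<times> Car A s \<inter> (\<Inter>i<Suc n. K i s))"
    by (auto simp: cgr_inter_def lessThan_Suc restrict_def fun_eq_iff)
  ultimately show ?case by (simp only:)
qed

text \<open>Classes of a kernel are the nonempty fibres of the map: values are sent to fibres in one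
  direction, and in the other each class is sent to the single value that \<open>f\<close> takes on
  it.\<close>

lemma finite_quotient_Ker:
  assumes "s \<in> S"
  shows "finite (Car A s // Ker S A f s) \<longleftrightarrow> finite (f s ` Car A s)"
proof
  assume "finite (f s ` Car A s)"
  moreover have "Car A s // Ker S A f s \<subseteq> (\<lambda>y. {x \<in> Car A s. y = f s x}) ` f s ` Car A s"
    using assms by (auto simp: quotient_def Ker_def image_iff)
  ultimately show "finite (Car A s // Ker S A f s)"
    by (meson finite_imageI finite_subset)
next
  assume fin: "finite (Car A s // Ker S A f s)"
  have "f s ` Car A s \<subseteq> (\<lambda>X. the_elem (f s ` X)) ` (Car A s // Ker S A f s)"
  proof clarify
    fix x assume x: "x \<in> Car A s"
    then have "f s ` (Ker S A f s `` {x}) = {f s x}"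
      using assms by (auto simp: Ker_iff)
    moreover have "Ker S A f s `` {x} \<in> Car A s // Ker S A f s"
      using x by (rule quotientI)
    ultimately show "f s x \<in> (\<lambda>X. the_elem (f s ` X)) ` (Car A s // Ker S A f s)"
      by (metis imageI the_elem_eq)
  qed
  with fin show "finite (f s ` Car A s)"
    by (meson finite_imageI finite_subset)
qed

text \<open>Finiteness of the set of sorts enters through this equivalence: a coproduct over
  finitely many sorts is finite once each component is. It turns all later finiteness arguments into
  arguments in one sort.\<close>

lemma sorted_finite_iff:
  assumes "finite S"
  shows "sorted_finite S X \<longleftrightarrow> (\<forall>s\<in>S. finite (X s))"
proof
  assume "sorted_finite S X"
  then have "finite (snd ` (SIGMA s:S. X s))"
    by (simp add: sorted_finite_def)
  moreover have "X s \<subseteq> snd ` (SIGMA s:S. X s)" if "s \<in> S" for s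
    using that by force
  ultimately show "\<forall>s\<in>S. finite (X s)" by (blast intro: finite_subset)
qed (use assms in \<open>simp add: sorted_finite_def\<close>)

text \<open>A copy of the empty product on elements of the universe, with \<open>undefined\<close>
  as an arbitrary point. Condition (4) with no factors puts it into every formation.\<close>

definition final_algebra ::
    "'s set \<Rightarrow> ('s list \<Rightarrow> 's \<Rightarrow> 'f set) \<Rightarrow> ('s, 'f, 'a) salgebra" where
  "final_algebra S \<Sigma> = \<lparr>Car = (\<lambda>s\<in>S. {undefined}), Opn = (\<lambda>(w, s, \<sigma>)\<in>opsyms S \<Sigma>.
     \<lambda>xs\<in>word_prod (\<lambda>s\<in>S. {undefined}) w. undefined)\<rparr>"

text \<open>Extracts what the correspondence uses of the universe axioms and of the support
  hypothesis: room for injecting finite quotients, their images as admissible carriers, and sortwise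
  finiteness.\<close>

locale finite_sorts_universe =
  fixes U :: "'a set set" and S :: "'s set" and \<Sigma> :: "'s list \<Rightarrow> 's \<Rightarrow> 'f set"
  assumes infinite_universe: "infinite (UNIV :: 'a set)"
    and finite_in_universe: "finite X \<Longrightarrow> X \<in> U"
    and finite_sorts: "finite S"
begin

lemmas sorted_finite_iff' = sorted_finite_iff[OF finite_sorts]

lemma finite_index_Ker:
  "f \<in> sepi S \<Sigma> A B \<Longrightarrow> finite_index S A (Ker S A f) \<longleftrightarrow> finite_algebra S B"
  by (simp add: finite_index_def finite_algebra_def sorted_finite_iff' finite_quotient_Ker sepi_image)

lemma finite_sepi:
  "f \<in> sepi S \<Sigma> A B \<Longrightarrow> finite_algebra S A \<Longrightarrow> finite_algebra S B"
  by (auto simp: finite_algebra_def sorted_finite_iff' dest: sepi_image[symmetric])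

text \<open>Realises a finite quotient, which lives on a type of sets of terms, inside the universe.\<close>

lemma finite_index_realisation:
  assumes A: "is_algebra S \<Sigma> A" and \<Phi>: "\<Phi> \<in> congruences S \<Sigma> A" and fin: "finite_index S A \<Phi>"
  obtains C f where "C \<in> Alg U S \<Sigma>" "f \<in> sepi S \<Sigma> A C" "Ker S A f = \<Phi>"
proof -
  have finq: "finite (Car A s // \<Phi> s)" if "s \<in> S" for s
    using fin that by (simp add: finite_index_def sorted_finite_iff')
  have "\<exists>j :: _ \<Rightarrow> 'a. inj_on j (Car A s // \<Phi> s)" if "s \<in> S" for s
    using infinite_arbitrarily_large[OF infinite_universe, of "card (Car A s // \<Phi> s)"] finq[OF that]
    by (metis finite_same_card_bij bij_betw_def)
  then obtain j :: "'s \<Rightarrow> _ \<Rightarrow> 'a" where j: "\<And>s. s \<in> S \<Longrightarrow> inj_on (j s) (Car A s // \<Phi> s)"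
    by metis
  \<comment> \<open>Injectivity of \<open>j\<close> keeps the kernel equal to \<open>\<Phi>\<close>;
    since this is a congruence, the image of \<open>f\<close> can be given operations making
    \<open>f\<close> a homomorphism.\<close>
  define f where "f = scomp j (quot_proj \<Phi>)"
  have q: "quot_proj \<Phi> s x \<in> Car A s // \<Phi> s" if "x \<in> Car A s" for s x
    using that by (simp add: quot_proj_def quotientI)
  have "Ker S A f = Ker S A (quot_proj \<Phi>)"
  proof (rule extensionalityI[OF Ker_extensional Ker_extensional])
    show "Ker S A f s = Ker S A (quot_proj \<Phi>) s" if "s \<in> S" for s
      using inj_on_eq_iff[OF j[OF that] q q] by (auto simp: Ker_iff[OF that] f_def scomp_def)
  qed
  then have K: "Ker S A f = \<Phi>"
    by (simp add: Ker_quot_proj[OF \<Phi>])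
  obtain C where C: "is_algebra S \<Sigma> C" "Car C = (\<lambda>s\<in>S. f s ` Car A s)" "f \<in> sepi S \<Sigma> A C"
    using image_algebra[OF A, of f] \<Phi> K by blast
  have "finite (f s ` Car A s)" if "s \<in> S" for s
    using finq[OF that] finite_quotient_Ker[OF that, of A f] K by simp
  then have "C \<in> Alg U S \<Sigma>"
    using C by (auto simp: Alg_def sorted_sets_def finite_in_universe)
  with C K show thesis by (intro that)
qed

section \<open>From formations of finite algebras to formations of congruences\<close>

lemma formation_congruences_finite_index:
  assumes "finite_algebra_formation U S \<Sigma> F" "A \<in> sorted_sets U S" "\<Phi> \<in> formation_congruences U S \<Sigma> F A"
  shows "finite_index S (free_algebra S \<Sigma> A) \<Phi>"
  using assms by (auto simp: formation_congruences_iff finite_index_Ker finite_algebra_formation_def)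

lemma formation_congruences_congruence:
  assumes "A \<in> sorted_sets U S" "\<Phi> \<in> formation_congruences U S \<Sigma> F A"
  shows "\<Phi> \<in> congruences S \<Sigma> (free_algebra S \<Sigma> A)"
  using assms by (auto simp: formation_congruences_iff intro: Ker_congruence[OF free_is_algebra sepi_shom])

text \<open>Each filter law comes from one closure condition: the full congruence from the empty
  subdirect product, intersections from subdirect products of two factors, upward closure from
  epimorphic images. In each case the quotient has finite index, is copied into the universe, and
  the copy is shown to lie in \<open>F\<close>.\<close>

lemma formation_congruences_filter:
  assumes FF: "finite_algebra_formation U S \<Sigma> F" and A: "A \<in> sorted_sets U S"
  shows "cgr_filter S \<Sigma> (free_algebra S \<Sigma> A) (formation_congruences U S \<Sigma> F A)"
    (is "cgr_filter _ _ _ (?G A)")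
proof -
  from FF have F: "algebra_formation U S \<Sigma> F" and fin: "\<And>B. B \<in> F \<Longrightarrow> finite_algebra S B"
    by (auto simp: finite_algebra_formation_def)
  let ?T = "free_algebra S \<Sigma> A"
  note T = free_is_algebra[of S \<Sigma> A]
  have full: "(\<lambda>s\<in>S. Car ?T s \<times> Car ?T s) \<in> ?G A"
  proof -
    have "finite_index S ?T (\<lambda>s\<in>S. Car ?T s \<times> Car ?T s)"
    proof -
      have "Car ?T s // (Car ?T s \<times> Car ?T s) \<subseteq> {Car ?T s}" for s
        by (auto simp: quotient_def)
      then show ?thesis
        by (auto simp: finite_index_def sorted_finite_iff' intro: finite_subset)
    qed
    from finite_index_realisation[OF T full_congruence[OF T] this]
    obtain C f where C: "C \<in> Alg U S \<Sigma>" and f: "f \<in> sepi S \<Sigma> ?T C"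
      and K: "Ker S ?T f = (\<lambda>s\<in>S. Car ?T s \<times> Car ?T s)" .
    have "x = y" if s: "s \<in> S" and xy: "x \<in> Car C s" "y \<in> Car C s" for s x y
    proof -
      obtain t u where tu: "t \<in> Car ?T s" "u \<in> Car ?T s" "x = f s t" "y = f s u"
        using xy sepi_image[OF f s] by blast
      then have "(t, u) \<in> Ker S ?T f s" using s by (simp add: K)
      then show ?thesis using tu s by (simp add: Ker_iff)
    qed
    \<comment> \<open>The copy has at most one element in each sort, and none where the free algebra
      is empty; the empty family of epimorphisms separates its points in either case.\<close>
    then have "C \<in> F"
      by (intro algebra_formation_subdirect[OF F C, where n = 0]) auto
    with f K show ?thesis
      using formation_congruences_iff[OF A] by metis
  qed
  moreover have "cgr_inter S \<Phi> \<Psi> \<in> ?G A" if "\<Phi> \<in> ?G A" "\<Psi> \<in> ?G A" for \<Phi> \<Psi>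
  proof -
    from that obtain B f B' f' where B: "B \<in> F" "f \<in> sepi S \<Sigma> ?T B" "\<Phi> = Ker S ?T f"
      and B': "B' \<in> F" "f' \<in> sepi S \<Sigma> ?T B'" "\<Psi> = Ker S ?T f'"
      by (auto simp: formation_congruences_iff[OF A])
    let ?\<Xi> = "cgr_inter S \<Phi> \<Psi>"
    \<comment> \<open>The intersection is the kernel of the pairing of \<open>f\<close> and
      \<open>f'\<close>. Its image lies in the product of two finite carriers, which gives finite
      index.\<close>
    define k where "k = (\<lambda>s t. (f s t, f' s t))"
    have \<Xi>: "?\<Xi> = Ker S ?T k"
      by (auto simp: cgr_inter_def B(3) B'(3) Ker_def k_def restrict_def fun_eq_iff)
    have cgr: "?\<Xi> \<in> congruences S \<Sigma> ?T"
      using formation_congruences_congruence[OF A] that by (simp add: cgr_inter_congruence)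
    have "finite (k s ` Car ?T s)" if "s \<in> S" for s
    proof (rule finite_subset)
      show "k s ` Car ?T s \<subseteq> Car B s \<times> Car B' s"
        using sepi_image[OF B(2) that] sepi_image[OF B'(2) that] by (auto simp: k_def)
      show "finite (Car B s \<times> Car B' s)"
        using fin[OF B(1)] fin[OF B'(1)] that by (simp add: finite_algebra_def sorted_finite_iff')
    qed
    then have "finite_index S ?T ?\<Xi>"
      by (simp add: finite_index_def sorted_finite_iff' \<Xi> finite_quotient_Ker)
    from finite_index_realisation[OF T cgr this]
    obtain D d where D: "D \<in> Alg U S \<Sigma>" and d: "d \<in> sepi S \<Sigma> ?T D" and K: "Ker S ?T d = ?\<Xi>" .
    have "cgr_le S (Ker S ?T d) (Ker S ?T f)" "cgr_le S (Ker S ?T d) (Ker S ?T f')"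
      by (auto simp: K cgr_le_def cgr_inter_def B(3) B'(3))
    then obtain p p' where p: "p \<in> sepi S \<Sigma> D B" "\<And>s x. s \<in> S \<Longrightarrow> x \<in> Car ?T s \<Longrightarrow> p s (d s x) = f s x"
      and p': "p' \<in> sepi S \<Sigma> D B'" "\<And>s x. s \<in> S \<Longrightarrow> x \<in> Car ?T s \<Longrightarrow> p' s (d s x) = f' s x"
      using sepi_factor[OF T d B(2)] sepi_factor[OF T d B'(2)] by metis
    \<comment> \<open>The induced epimorphisms \<open>p\<close> and \<open>p'\<close> separate
      points of \<open>D\<close> because the kernel of \<open>d\<close> is no larger than the
      intersection of the kernels of \<open>f\<close> and \<open>f'\<close>.\<close>
    have "D \<in> F"
    proof (rule algebra_formation_subdirect[OF F D, where n = 2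
          and C = "\<lambda>i. if i = 0 then B else B'" and h = "\<lambda>i. if i = 0 then p else p'"])
      fix s x y assume s: "s \<in> S" and xy: "x \<in> Car D s" "y \<in> Car D s"
        and eq: "\<And>i::nat. i < 2 \<Longrightarrow> (if i = 0 then p else p') s x = (if i = 0 then p else p') s y"
      obtain t u where tu: "t \<in> Car ?T s" "u \<in> Car ?T s" "x = d s t" "y = d s u"
        using xy sepi_image[OF d s] by blast
      have "p s x = p s y" "p' s x = p' s y"
        using eq[of 0] eq[of 1] by simp_all
      then have "(t, u) \<in> Ker S ?T d s"
        using s tu p(2) p'(2) by (simp add: K \<Xi> Ker_iff k_def)
      with s tu show "x = y" by (simp add: Ker_iff)
    qed (use B B' p p' in auto)
    with d K show ?thesis
      using formation_congruences_iff[OF A] by metis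
  qed
  moreover have "\<Psi> \<in> ?G A"
    if \<Phi>: "\<Phi> \<in> ?G A" and \<Psi>: "\<Psi> \<in> congruences S \<Sigma> ?T" and le: "cgr_le S \<Phi> \<Psi>" for \<Phi> \<Psi>
  proof -
    from \<Phi> obtain B f where B: "B \<in> F" "f \<in> sepi S \<Sigma> ?T B" "\<Phi> = Ker S ?T f"
      by (auto simp: formation_congruences_iff[OF A])
    have "finite_index S ?T \<Psi>"
    proof -
      have "finite (Car ?T s // \<Psi> s)" if s: "s \<in> S" for s
      proof (rule finite_refines_finite)
        show "finite (Car ?T s // \<Phi> s)"
          using formation_congruences_finite_index[OF FF A \<Phi>] s by (simp add: finite_index_def sorted_finite_iff')
      qed (use le s congruence_equiv[OF \<Psi> s] congruence_equiv[OF formation_congruences_congruence[OF A \<Phi>] s]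
          in \<open>auto simp: cgr_le_def\<close>)
      then show ?thesis by (simp add: finite_index_def sorted_finite_iff')
    qed
    from finite_index_realisation[OF T \<Psi> this]
    obtain C g where C: "C \<in> Alg U S \<Sigma>" and g: "g \<in> sepi S \<Sigma> ?T C" and K: "Ker S ?T g = \<Psi>" .
    \<comment> \<open>The inclusion of \<Phi> in \<Psi> is an inclusion of kernels, so the larger
      congruence presents an epimorphic image of \<open>B\<close>.\<close>
    obtain h where "h \<in> sepi S \<Sigma> B C"
      using sepi_factor[OF T B(2) g] le B(3) K by metis
    then have "C \<in> F"
      by (rule algebra_formation_epi[OF F B(1) C])
    with g K show ?thesis
      using formation_congruences_iff[OF A] by metis
  qed
  ultimately show ?thesis
    using formation_congruences_congruence[OF A] unfolding cgr_filter_def by blast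
qed

text \<open>The hypothesis \<open>epi\<close> does not make \<open>f\<close> onto; it says that
  every class of \<open>\<Theta>\<close> is the class of some value of \<open>f\<close>. As the
  classes of \<open>\<Theta>\<close> are the fibres of \<open>g\<close>, the composite of
  \<open>g\<close> and \<open>f\<close> is onto \<open>C\<close> and has the same kernel as the
  projection after \<open>f\<close>.\<close>

lemma formation_congruences_pullback:
  assumes A: "A \<in> sorted_sets U S" and B: "B \<in> sorted_sets U S"
    and \<Theta>: "\<Theta> \<in> formation_congruences U S \<Sigma> F B"
    and f: "f \<in> shom S \<Sigma> (free_algebra S \<Sigma> A) (free_algebra S \<Sigma> B)"
    and epi: "scomp (quot_proj \<Theta>) f
      \<in> sepi S \<Sigma> (free_algebra S \<Sigma> A) (quot_algebra S \<Sigma> (free_algebra S \<Sigma> B) \<Theta>)"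
  shows "Ker S (free_algebra S \<Sigma> A) (scomp (quot_proj \<Theta>) f) \<in> formation_congruences U S \<Sigma> F A"
proof -
  let ?T = "free_algebra S \<Sigma> A" and ?T' = "free_algebra S \<Sigma> B"
  from \<Theta> obtain C g where C: "C \<in> F" and g: "g \<in> sepi S \<Sigma> ?T' C" and K: "\<Theta> = Ker S ?T' g"
    by (auto simp: formation_congruences_iff[OF B])
  have \<Theta>c: "\<Theta> \<in> congruences S \<Sigma> ?T'" by (rule formation_congruences_congruence[OF B \<Theta>])
  note qeq = quot_proj_Ker_eq_iff[OF free_is_algebra sepi_shom[OF g], folded K]
  note fc = shom_closed[OF f]
  have "Car C s \<subseteq> (\<lambda>x. g s (f s x)) ` Car ?T s" if s: "s \<in> S" for s
  proof
    fix c assume "c \<in> Car C s"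
    then obtain t where t: "t \<in> Car ?T' s" "c = g s t"
      using sepi_image[OF g s] by blast
    then have "quot_proj \<Theta> s t \<in> Car (quot_algebra S \<Sigma> ?T' \<Theta>) s"
      using shom_closed[OF sepi_shom[OF quot_proj_sepi[OF free_is_algebra \<Theta>c]] s] by blast
    then obtain u where u: "u \<in> Car ?T s" "quot_proj \<Theta> s t = quot_proj \<Theta> s (f s u)"
      using sepi_image[OF epi s] by (auto simp: scomp_def)
    with t show "c \<in> (\<lambda>x. g s (f s x)) ` Car ?T s"
      using qeq[OF s t(1) fc[OF s u(1)]] by blast
  qed
  then have "scomp g f \<in> sepi S \<Sigma> ?T C"
    using shom_comp[OF f sepi_shom[OF g]] fc shom_closed[OF sepi_shom[OF g]]
    by (fastforce simp: sepi_def scomp_def)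
  moreover have "Ker S ?T (scomp (quot_proj \<Theta>) f) = Ker S ?T (scomp g f)"
  proof (rule extensionalityI[OF Ker_extensional Ker_extensional])
    show "Ker S ?T (scomp (quot_proj \<Theta>) f) s = Ker S ?T (scomp g f) s" if s: "s \<in> S" for s
      using fc[OF s] qeq[OF s] by (auto simp: Ker_iff[OF s] scomp_def)
  qed
  ultimately show ?thesis
    using C formation_congruences_iff[OF A] by blast
qed

lemma formation_congruences_closed:
  assumes F: "finite_algebra_formation U S \<Sigma> F"
  shows "finite_index_congruence_formation U S \<Sigma> (formation_congruences U S \<Sigma> F)"
    (is "finite_index_congruence_formation _ _ _ ?G")
proof -
  have "congruence_formation U S \<Sigma> ?G"
    unfolding congruence_formation_def
  proof (intro conjI ballI impI)
    show "?G \<in> extensional (sorted_sets U S)"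
      by (simp add: formation_congruences_def)
  qed (fact formation_congruences_filter[OF F], rule formation_congruences_pullback)
  then show ?thesis
    using formation_congruences_finite_index[OF F] by (simp add: finite_index_congruence_formation_def)
qed

section \<open>From formations of congruences back to formations of finite algebras\<close>

lemma formation_algebras_closed:
  assumes "finite_index_congruence_formation U S \<Sigma> G"
  shows "finite_algebra_formation U S \<Sigma> (formation_algebras U S \<Sigma> G)"
    (is "finite_algebra_formation _ _ _ ?F")
proof -
  from assms have G: "congruence_formation U S \<Sigma> G"
    and fin: "\<And>A \<Theta>. A \<in> sorted_sets U S \<Longrightarrow> \<Theta> \<in> G A \<Longrightarrow> finite_index S (free_algebra S \<Sigma> A) \<Theta>"
    by (auto simp: finite_index_congruence_formation_def)
  have finF: "finite_algebra S B" if "B \<in> ?F" for B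
    using that by (rule formation_algebrasE) (use fin finite_index_Ker in blast)
  have nonempty: "?F \<noteq> {}"
  proof -
    \<comment> \<open>Any sorted set would do as generators; the empty one is certainly available,
      and the filter over it contains some congruence to realise.\<close>
    have E: "(\<lambda>s\<in>S. {}) \<in> sorted_sets U S"
      by (simp add: sorted_sets_def finite_in_universe)
    then obtain \<Theta> where \<Theta>: "\<Theta> \<in> G (\<lambda>s\<in>S. {})"
      "\<Theta> \<in> congruences S \<Sigma> (free_algebra S \<Sigma> (\<lambda>s\<in>S. {}))"
      using congruence_formation_filter[OF G E] unfolding cgr_filter_def by blast
    from finite_index_realisation[OF free_is_algebra \<Theta>(2) fin[OF E \<Theta>(1)]] \<Theta>(1) E
    show ?thesis by (metis formation_algebrasI empty_iff)
  qed
  have epi: "A \<in> ?F" if B: "B \<in> ?F" and A: "A \<in> Alg U S \<Sigma>" and h: "h \<in> sepi S \<Sigma> B A" for A B h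
  proof -
    from B obtain X f where X: "X \<in> sorted_sets U S" and f: "f \<in> sepi S \<Sigma> (free_algebra S \<Sigma> X) B"
      and K: "Ker S (free_algebra S \<Sigma> X) f \<in> G X"
      by (rule formation_algebrasE)
    have hf: "scomp h f \<in> sepi S \<Sigma> (free_algebra S \<Sigma> X) A"
      by (rule sepi_comp[OF f h])
    \<comment> \<open>Composition with \<open>h\<close> can only enlarge the kernel, and filters are
      upward closed.\<close>
    have "Ker S (free_algebra S \<Sigma> X) (scomp h f) \<in> G X"
      by (rule cgr_filter_upward[OF congruence_formation_filter[OF G X] K
            Ker_congruence[OF free_is_algebra sepi_shom[OF hf]]])
        (auto simp: cgr_le_def Ker_def scomp_def)
    then show ?thesis by (rule formation_algebrasI[OF A X hf])
  qed
  have subdirect: "A \<in> ?F"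
    if A: "A \<in> Alg U S \<Sigma>" and C: "\<And>i. i < n \<Longrightarrow> C i \<in> ?F"
      and f: "subdirect_embedding S \<Sigma> A {..<n} C f" for n :: nat and C A f
  proof -
    let ?T = "free_algebra S \<Sigma> (Car A)"
    have X: "Car A \<in> sorted_sets U S" and alg: "is_algebra S \<Sigma> A"
      using A by (auto simp: Alg_def)
    obtain e where e: "e \<in> sepi S \<Sigma> ?T A" by (rule free_onto[OF alg])
    \<comment> \<open>Each factor \<open>C i\<close> has some presentation with kernel in
      \<open>G\<close>; transport to the epimorphism from \<open>?T\<close> through \<open>A\<close>
      puts \<open>K i\<close> into the filter over the carrier of \<open>A\<close>.\<close>
    define K where "K = (\<lambda>i. Ker S ?T (scomp (\<lambda>s x. f s x i) e))"
    have "K i \<in> G (Car A)" if i: "i < n" for i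
    proof -
      have "scomp (\<lambda>s x. f s x i) e \<in> sepi S \<Sigma> ?T (C i)"
        using i by (intro sepi_comp[OF e] subdirect_component[OF f]) simp
      moreover from C[OF i] obtain Y g where "Y \<in> sorted_sets U S"
        "g \<in> sepi S \<Sigma> (free_algebra S \<Sigma> Y) (C i)" "Ker S (free_algebra S \<Sigma> Y) g \<in> G Y"
        by (rule formation_algebrasE)
      ultimately show ?thesis
        unfolding K_def using congruence_formation_transport[OF G _ X] by blast
    qed
    then have "(\<lambda>s\<in>S. Car ?T s \<times> Car ?T s \<inter> (\<Inter>i<n. K i s)) \<in> G (Car A)"
      by (rule cgr_filter_Inter[OF congruence_formation_filter[OF G X] free_is_algebra])
    moreover have "(\<lambda>s\<in>S. Car ?T s \<times> Car ?T s \<inter> (\<Inter>i<n. K i s)) = Ker S ?T e"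
    proof (rule extensionalityI[OF restrict_extensional Ker_extensional])
      fix s assume s: "s \<in> S"
      note ec = shom_closed[OF sepi_shom[OF e] s]
      \<comment> \<open>Elements of the product are extensional, so agreement at all indices below
        \<open>n\<close> is equality of tuples, and injectivity of the embedding concludes. Hence
        the intersection of the \<open>K i\<close> is the kernel of \<open>e\<close>, also for
        \<open>n = 0\<close>.\<close>
      have "x = y" if "x \<in> Car A s" "y \<in> Car A s" "\<forall>i<n. f s x i = f s y i" for x y
      proof -
        have "f s z \<in> extensional {..<n}" if "z \<in> Car A s" for z
          using subdirect_PiE[OF f s that] by (simp add: PiE_iff)
        with that have "f s x = f s y"
          by (intro extensionalityI[of _ "{..<n}"]) auto
        then show ?thesis
          using f s that by (auto simp: subdirect_embedding_def inj_on_def)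
      qed
      then show "(\<lambda>s\<in>S. Car ?T s \<times> Car ?T s \<inter> (\<Inter>i<n. K i s)) s = Ker S ?T e s"
        using s ec by (auto simp: K_def Ker_iff scomp_def)
    qed
    ultimately show ?thesis
      by (intro formation_algebrasI[OF A X e]) simp
  qed
  have "?F \<subseteq> Alg U S \<Sigma>" by (auto simp: formation_algebras_def)
  then have "algebra_formation U S \<Sigma> ?F"
    using nonempty epi subdirect by (rule algebra_formationI)
  with finF show ?thesis by (simp add: finite_algebra_formation_def)
qed

text \<open>For one inclusion, \<open>B\<close> and a member \<open>C\<close> of \<open>F\<close>
  are presented with the same kernel, which yields an epimorphism from \<open>C\<close> onto
  \<open>B\<close>; for the other, \<open>B\<close> is presented by the free algebra on its own
  carrier.\<close>

lemma formation_algebras_congruences: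
  assumes "finite_algebra_formation U S \<Sigma> F"
  shows "formation_algebras U S \<Sigma> (formation_congruences U S \<Sigma> F) = F"
proof
  from assms have F: "algebra_formation U S \<Sigma> F"
    by (simp add: finite_algebra_formation_def)
  show "formation_algebras U S \<Sigma> (formation_congruences U S \<Sigma> F) \<subseteq> F"
  proof
    fix B assume "B \<in> formation_algebras U S \<Sigma> (formation_congruences U S \<Sigma> F)"
    then obtain A f where B: "B \<in> Alg U S \<Sigma>" and A: "A \<in> sorted_sets U S"
      and f: "f \<in> sepi S \<Sigma> (free_algebra S \<Sigma> A) B"
      and K: "Ker S (free_algebra S \<Sigma> A) f \<in> formation_congruences U S \<Sigma> F A"
      by (rule formation_algebrasE)
    from K obtain C g where C: "C \<in> F" and g: "g \<in> sepi S \<Sigma> (free_algebra S \<Sigma> A) C"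
      and eq: "Ker S (free_algebra S \<Sigma> A) f = Ker S (free_algebra S \<Sigma> A) g"
      by (auto simp: formation_congruences_iff[OF A])
    obtain h where "h \<in> sepi S \<Sigma> C B"
      by (rule sepi_factor[OF free_is_algebra g f]) (simp_all add: eq cgr_le_def)
    then show "B \<in> F" by (rule algebra_formation_epi[OF F C B])
  qed
  show "F \<subseteq> formation_algebras U S \<Sigma> (formation_congruences U S \<Sigma> F)"
  proof
    fix B assume B: "B \<in> F"
    then have alg: "B \<in> Alg U S \<Sigma>" using algebra_formation_Alg[OF F] by blast
    then have A: "Car B \<in> sorted_sets U S" and B': "is_algebra S \<Sigma> B" by (auto simp: Alg_def)
    obtain e where e: "e \<in> sepi S \<Sigma> (free_algebra S \<Sigma> (Car B)) B"
      by (rule free_onto[OF B'])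
    show "B \<in> formation_algebras U S \<Sigma> (formation_congruences U S \<Sigma> F)"
      by (intro formation_algebrasI[OF alg A e]) (use B e formation_congruences_iff[OF A] in blast)
  qed
qed

text \<open>One inclusion is transport between presentations of the same algebra. The other uses
  finite index, which provides an algebra in the universe with the given congruence as
  kernel.\<close>

lemma formation_congruences_algebras:
  assumes "finite_index_congruence_formation U S \<Sigma> G"
  shows "formation_congruences U S \<Sigma> (formation_algebras U S \<Sigma> G) = G"
proof (rule extensionalityI)
  from assms have G: "congruence_formation U S \<Sigma> G"
    and fin: "\<And>A \<Theta>. A \<in> sorted_sets U S \<Longrightarrow> \<Theta> \<in> G A \<Longrightarrow> finite_index S (free_algebra S \<Sigma> A) \<Theta>"
    by (auto simp: finite_index_congruence_formation_def)
  show "G \<in> extensional (sorted_sets U S)"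
    by (rule congruence_formation_extensional[OF G])
  fix A assume A: "A \<in> sorted_sets U S"
  show "formation_congruences U S \<Sigma> (formation_algebras U S \<Sigma> G) A = G A"
  proof (intro equalityI subsetI)
    fix \<Phi> assume "\<Phi> \<in> formation_congruences U S \<Sigma> (formation_algebras U S \<Sigma> G) A"
    then obtain B f where B: "B \<in> formation_algebras U S \<Sigma> G"
      and f: "f \<in> sepi S \<Sigma> (free_algebra S \<Sigma> A) B" "\<Phi> = Ker S (free_algebra S \<Sigma> A) f"
      by (auto simp: formation_congruences_iff[OF A])
    from B show "\<Phi> \<in> G A"
      by (rule formation_algebrasE) (use f congruence_formation_transport[OF G _ A] in blast)
  next
    fix \<Phi> assume \<Phi>: "\<Phi> \<in> G A"
    then have "\<Phi> \<in> congruences S \<Sigma> (free_algebra S \<Sigma> A)"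
      using congruence_formation_filter[OF G A] unfolding cgr_filter_def by blast
    from finite_index_realisation[OF free_is_algebra this fin[OF A \<Phi>]]
    obtain C f where "C \<in> Alg U S \<Sigma>" "f \<in> sepi S \<Sigma> (free_algebra S \<Sigma> A) C"
      "Ker S (free_algebra S \<Sigma> A) f = \<Phi>" .
    then show "\<Phi> \<in> formation_congruences U S \<Sigma> (formation_algebras U S \<Sigma> G) A"
      using \<Phi> formation_algebrasI[of C U S \<Sigma> A f G] A formation_congruences_iff[OF A] by metis
  qed
qed (simp add: formation_congruences_def)

section \<open>Order, greatest formation and completeness\<close>

lemma final_algebra_Alg: "final_algebra S \<Sigma> \<in> Alg U S \<Sigma>"
proof -
  have "is_algebra S \<Sigma> (final_algebra S \<Sigma> :: ('s, 'f, 'a) salgebra)"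
    unfolding final_algebra_def by (rule is_algebraI) (auto dest: opsyms_sort)
  then show ?thesis
    by (simp add: final_algebra_def Alg_def sorted_sets_def finite_in_universe)
qed

lemma final_algebra_in_formation:
  assumes "algebra_formation U S \<Sigma> F"
  shows "final_algebra S \<Sigma> \<in> F"
  by (rule algebra_formation_subdirect[OF assms final_algebra_Alg, where n = 0])
    (auto simp: final_algebra_def)

lemma finite_algebras_formation:
  "finite_algebra_formation U S \<Sigma> {A \<in> Alg U S \<Sigma>. finite_algebra S A}"
    (is "finite_algebra_formation _ _ _ ?F")
proof -
  have subdirect: "finite_algebra S A"
    if f: "subdirect_embedding S \<Sigma> A {..<n} C f" and C: "\<And>i. i < n \<Longrightarrow> finite_algebra S (C i)"
    for n :: nat and C A f
  proof -
    have "finite (Car A s)" if s: "s \<in> S" for s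
    proof (rule finite_imageD)
      show "inj_on (f s) (Car A s)"
        using f s by (simp add: subdirect_embedding_def)
      have "finite (\<Pi>\<^sub>E i\<in>{..<n}. Car (C i) s)"
        using C s by (intro finite_PiE) (auto simp: finite_algebra_def sorted_finite_iff')
      moreover have "f s ` Car A s \<subseteq> (\<Pi>\<^sub>E i\<in>{..<n}. Car (C i) s)"
        using subdirect_PiE[OF f s] by blast
      ultimately show "finite (f s ` Car A s)" by (rule finite_subset[rotated])
    qed
    then show ?thesis by (simp add: finite_algebra_def sorted_finite_iff')
  qed
  have "final_algebra S \<Sigma> \<in> ?F"
    using final_algebra_Alg
    by (simp add: final_algebra_def finite_algebra_def sorted_finite_iff')
  have "algebra_formation U S \<Sigma> ?F"
  proof (rule algebra_formationI)
    show "A \<in> ?F" if "B \<in> ?F" "A \<in> Alg U S \<Sigma>" "f \<in> sepi S \<Sigma> B A" for A B f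
      using that finite_sepi by blast
    show "A \<in> ?F" if "A \<in> Alg U S \<Sigma>" "\<And>i. i < n \<Longrightarrow> C i \<in> ?F"
      "subdirect_embedding S \<Sigma> A {..<n} C f" for n :: nat and C A f
      using that(1,2) subdirect[OF that(3)] by blast
  qed (use \<open>final_algebra S \<Sigma> \<in> ?F\<close> in auto)
  then show ?thesis by (simp add: finite_algebra_formation_def)
qed

lemma partial_order_Form_Algf: "partial_order (Form_Algf U S \<Sigma>)"
  by (rule partial_orderI) (auto simp: Form_Algf_def)

text \<open>The order compares values on sorted sets only; antisymmetry holds because members are
  fixed as \<open>undefined\<close> elsewhere.\<close>

lemma partial_order_Form_Cgrfi: "partial_order (Form_Cgrfi U S \<Sigma>)"
proof (rule partial_orderI)
  fix G H assume "G \<in> carrier (Form_Cgrfi U S \<Sigma>)" "H \<in> carrier (Form_Cgrfi U S \<Sigma>)"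
    and le: "G \<sqsubseteq>\<^bsub>Form_Cgrfi U S \<Sigma>\<^esub> H" "H \<sqsubseteq>\<^bsub>Form_Cgrfi U S \<Sigma>\<^esub> G"
  then have "G \<in> extensional (sorted_sets U S)" "H \<in> extensional (sorted_sets U S)"
    by (auto simp: Form_Cgrfi_def finite_index_congruence_formation_def
        dest: congruence_formation_extensional)
  then show "G = H"
    by (rule extensionalityI) (use le in \<open>auto simp: Form_Cgrfi_def\<close>)
qed (auto simp: Form_Cgrfi_def)

text \<open>The final algebra is common to all formations, so the intersection is nonempty. The
  assumption \<open>ne\<close> keeps it inside the set of algebras, as the intersection of the empty
  collection is the whole type.\<close>

lemma formation_Inter:
  assumes ne: "X \<noteq> {}" and X: "\<And>F. F \<in> X \<Longrightarrow> finite_algebra_formation U S \<Sigma> F"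
  shows "finite_algebra_formation U S \<Sigma> (\<Inter>X)"
proof -
  have F: "algebra_formation U S \<Sigma> F" if "F \<in> X" for F
    using X[OF that] by (simp add: finite_algebra_formation_def)
  have "algebra_formation U S \<Sigma> (\<Inter>X)"
  proof (rule algebra_formationI)
    show "\<Inter>X \<subseteq> Alg U S \<Sigma>"
      using ne F algebra_formation_Alg by blast
    show "\<Inter>X \<noteq> {}"
      using F final_algebra_in_formation by blast
    show "A \<in> \<Inter>X" if "B \<in> \<Inter>X" "A \<in> Alg U S \<Sigma>" "f \<in> sepi S \<Sigma> B A" for A B f
      using that F algebra_formation_epi by blast
    show "A \<in> \<Inter>X" if "A \<in> Alg U S \<Sigma>" "\<And>i. i < n \<Longrightarrow> C i \<in> \<Inter>X"
      "subdirect_embedding S \<Sigma> A {..<n} C f" for A C f and n :: nat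
    proof
      show "A \<in> Y" if Y: "Y \<in> X" for Y
        using F[OF Y] Y \<open>A \<in> Alg U S \<Sigma>\<close> \<open>\<And>i. i < n \<Longrightarrow> C i \<in> \<Inter>X\<close>
          \<open>subdirect_embedding S \<Sigma> A {..<n} C f\<close>
        unfolding algebra_formation_def by blast
    qed
  qed
  then show ?thesis
    using ne X unfolding finite_algebra_formation_def by blast
qed

text \<open>The formation of all finite algebras is the infimum of the empty family; other infima
  are intersections, and suprema follow as infima of upper bounds.\<close>

lemma complete_lattice_Form_Algf: "complete_lattice (Form_Algf U S \<Sigma>)"
proof (rule partial_order.complete_lattice_criterion1[OF partial_order_Form_Algf])
  have "greatest (Form_Algf U S \<Sigma>) {A \<in> Alg U S \<Sigma>. finite_algebra S A} (carrier (Form_Algf U S \<Sigma>))"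
    using finite_algebras_formation
    by (auto simp: greatest_def Form_Algf_def finite_algebra_formation_def dest: algebra_formation_Alg)
  then show "\<exists>g. greatest (Form_Algf U S \<Sigma>) g (carrier (Form_Algf U S \<Sigma>))" ..
  fix X assume X: "X \<subseteq> carrier (Form_Algf U S \<Sigma>)" "X \<noteq> {}"
  then have "greatest (Form_Algf U S \<Sigma>) (\<Inter>X) (Lower (Form_Algf U S \<Sigma>) X)"
    using formation_Inter[of X] by (auto simp: greatest_def Lower_def Form_Algf_def)
  then show "\<exists>i. greatest (Form_Algf U S \<Sigma>) i (Lower (Form_Algf U S \<Sigma>) X)" ..
qed

lemma formation_isomorphism:
  "bij_betw (formation_congruences U S \<Sigma>) (carrier (Form_Algf U S \<Sigma>)) (carrier (Form_Cgrfi U S \<Sigma>))"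
  "order_emb (Form_Algf U S \<Sigma>) (Form_Cgrfi U S \<Sigma>) (formation_congruences U S \<Sigma>)"
proof -
  show "bij_betw (formation_congruences U S \<Sigma>) (carrier (Form_Algf U S \<Sigma>))
      (carrier (Form_Cgrfi U S \<Sigma>))"
    by (rule bij_betw_byWitness[where f' = "formation_algebras U S \<Sigma>"])
      (auto simp: Form_Algf_def Form_Cgrfi_def formation_algebras_congruences
        formation_congruences_algebras formation_congruences_closed formation_algebras_closed)
  have mono: "formation_congruences U S \<Sigma> F A \<subseteq> formation_congruences U S \<Sigma> F' A"
    if "F \<subseteq> F'" "A \<in> sorted_sets U S" for F F' A
    using that by (simp add: formation_congruences_def) blast
  have "(\<forall>A\<in>sorted_sets U S. formation_congruences U S \<Sigma> F A \<subseteq> formation_congruences U S \<Sigma> F' A)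
      \<longleftrightarrow> F \<subseteq> F'"
    if "finite_algebra_formation U S \<Sigma> F" "finite_algebra_formation U S \<Sigma> F'" for F F'
  proof
    \<comment> \<open>The order is reflected because the inverse assignment is monotone as
      well.\<close>
    assume "\<forall>A\<in>sorted_sets U S. formation_congruences U S \<Sigma> F A \<subseteq> formation_congruences U S \<Sigma> F' A"
    then have "formation_algebras U S \<Sigma> (formation_congruences U S \<Sigma> F)
        \<subseteq> formation_algebras U S \<Sigma> (formation_congruences U S \<Sigma> F')"
      unfolding formation_algebras_def by blast
    then show "F \<subseteq> F'"
      by (simp add: formation_algebras_congruences that)
  qed (use mono in blast)
  then show "order_emb (Form_Algf U S \<Sigma>) (Form_Cgrfi U S \<Sigma>) (formation_congruences U S \<Sigma>)"
    unfolding order_emb_def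
    using partial_order.axioms(1)[OF partial_order_Form_Algf]
      partial_order.axioms(1)[OF partial_order_Form_Cgrfi]
    by (simp add: Form_Algf_def Form_Cgrfi_def)
qed

end

section \<open>Grothendieck universes\<close>

text \<open>Closure under subsets gives the empty set. Adjoining \<open>x\<close> to
  \<open>X\<close> is the union of the two members of the pair formed by \<open>{x, x}\<close> and
  \<open>X\<close>, taken with \<open>id\<close> as the indexed family.\<close>

lemma universe_finite_set:
  assumes U: "grothendieck_universe elts" and "finite X"
  shows "X \<in> range elts"
  using \<open>finite X\<close>
proof induction
  case empty
  then show ?case using U unfolding grothendieck_universe_def by blast
next
  case (insert x X)
  then obtain y where y: "X = elts y" by blast
  obtain z where z: "elts z = {x, x}"
    using U unfolding grothendieck_universe_def by (metis rangeE)
  obtain i where i: "elts i = {z, y}"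
    using U unfolding grothendieck_universe_def by (metis rangeE)
  have "(\<Union>x\<in>elts i. elts (id x)) \<in> range elts"
    using U unfolding grothendieck_universe_def by blast
  then show ?case by (simp add: i y z insert_commute)
qed

text \<open>Were there finitely many elements, the set of all of them would belong to the universe
  and contain itself, against foundation.\<close>

lemma universe_infinite:
  fixes elts :: "'u \<Rightarrow> 'u set"
  assumes U: "grothendieck_universe elts"
  shows "infinite (UNIV :: 'u set)"
proof
  assume "finite (UNIV :: 'u set)"
  then obtain v where "elts v = UNIV"
    using universe_finite_set[OF U] by (metis rangeE)
  then have "(v, v) \<in> {(x, y). x \<in> elts y}" by simp
  moreover have "wf {(x, y). x \<in> elts y}"
    using U by (simp add: grothendieck_universe_def)
  ultimately show False by (metis wf_not_refl)
qed

lemma finite_sorts_if_finite_supports: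
  assumes fin: "\<And>X. finite X \<Longrightarrow> X \<in> U"
    and supp: "\<forall>A\<in>sorted_sets U S. finite (support S (Car (free_algebra S \<Sigma> A)))"
  shows "finite S"
proof -
  let ?A = "\<lambda>s\<in>S. {undefined}"
  have "?A \<in> sorted_sets U S"
    by (simp add: sorted_sets_def fin)
  moreover have "Var s undefined \<in> Car (free_algebra S \<Sigma> ?A) s" if "s \<in> S" for s
    using that by (simp add: Car_free well_sorted.var)
  then have "support S (Car (free_algebra S \<Sigma> ?A)) = S"
    by (auto simp: support_def)
  ultimately show ?thesis using supp by metis
qed

theorem proposition6p14:
  fixes elts :: "'u \<Rightarrow> 'u set"
    and S :: "'u set"
    and \<Sigma> :: "'u list \<Rightarrow> 'u \<Rightarrow> 'u set"
  assumes "grothendieck_universe elts"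
    and "S \<in> range elts"
    and "\<forall>w\<in>lists S. \<forall>s\<in>S. \<Sigma> w s \<in> range elts"
    and "\<forall>A\<in>sorted_sets (range elts) S. finite (support S (Car (free_algebra S \<Sigma> A)))"
  shows "complete_lattice (Form_Algf (range elts) S \<Sigma>) \<and>
         complete_lattice (Form_Cgrfi (range elts) S \<Sigma>) \<and>
         lattice_isomorphic (Form_Algf (range elts) S \<Sigma>) (Form_Cgrfi (range elts) S \<Sigma>)"
proof -
  interpret finite_sorts_universe "range elts" S \<Sigma>
  proof
    show "infinite (UNIV :: 'u set)" by (rule universe_infinite[OF assms(1)])
    show fin: "X \<in> range elts" if "finite X" for X
      using universe_finite_set[OF assms(1) that] .
    show "finite S" using finite_sorts_if_finite_supports[OF fin assms(4)] .
  qed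
  have "complete_lattice (Form_Cgrfi (range elts) S \<Sigma>)"
    by (rule complete_lattice_transfer[OF complete_lattice_Form_Algf partial_order_Form_Cgrfi
          formation_isomorphism])
  then show ?thesis
    using complete_lattice_Form_Algf formation_isomorphism unfolding lattice_isomorphic_def by blast
qed

end
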